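(* Let $(\mathcal{H},d)$ be an Hadamard space, let $k\in\mathbb{N}$, and let $f_1,\dots,f_k\colon\mathcal{H}\to(-\infty,\infty]$ be convex lower semicontinuous functions such that $f:=\sum_{j=1}^k f_j$ is not identically equal to $\infty$. Let $J_\lambda$ and $S_t$ denote the resolvent and gradient flow semigroup of $f$, let $J^j_\lambda$ and $S^j_t$ denote the resolvent and gradient flow semigroup of $f_j$, and let $P_j$ denote the metric projection onto $\overline{\operatorname{dom}}\, f_j$, for $j=1,\dots,k$. Then, for every $t\in[0,\infty)$ and $x\in\overline{\operatorname{dom}}\, f$, \[ S_t(x)=\lim_{n\to\infty}\left(J^k_{t/n}\circ\cdots\circ J^1_{t/n}\right)^{(n)}(x), \] and if moreover there exists $1\le l\le k$ such that $\operatorname{dom} f_l$ is locally compact, then for every $t\in[0,\infty)$ and $x\in\overline{\operatorname{dom}}\, f$, \[ S_t(x)=\lim_{n\to\infty}\left(S^k_{t/n}\circ P_k\circ\cdots\circ S^1_{t/n}\circ P_1\right)^{(n)}(x). \]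
   Context: An Hadamard space is a complete geodesic metric space $(\mathcal{H},d)$ satisfying, for every $x\in\mathcal{H}$, every geodesic $\gamma\colon[0,1]\to\mathcal{H}$ and every $t\in[0,1]$: $d(x,\gamma(t))^2\le(1-t)d(x,\gamma(0))^2+t\,d(x,\gamma(1))^2-t(1-t)d(\gamma(0),\gamma(1))^2$. A function $g\colon\mathcal{H}\to(-\infty,\infty]$ is convex if $g\circ\gamma$ is convex for every geodesic $\gamma\colon[0,1]\to\mathcal{H}$; $\operatorname{dom} g=\{x: g(x)<\infty\}$ and $\overline{\operatorname{dom}}\, g$ is its closure. For a convex lsc $g$ (not identically $\infty$) and $\lambda>0$, the resolvent is $J_\lambda(x):=\arg\min_{y\in\mathcal{H}}\big[g(y)+\frac{1}{2\lambda}d(x,y)^2\big]$ (a well-defined map $\mathcal{H}\to\overline{\operatorname{dom}}\, g$), with $J_0(x):=x$; the gradient flow semigroup is $S_t(x):=\lim_{n\to\infty}(J_{t/n})^{(n)}(x)$ for $x\in\overline{\operatorname{dom}}\, g$, $t\ge0$ (this limit exists). For a map $F\colon\mathcal{H}\to\mathcal{H}$, $F^{(n)}$ denotes the $n$-fold composition $F\circ\cdots\circ F$, with $F^{(0)}$ the identity. For a nonempty closed convex set $C\subset\mathcal{H}$, the metric projection $P_C(x)$ is the unique point of $C$ nearest to $x$. *)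

theory Defs
  imports "HOL-Analysis.Analysis" "HOL-Library.Extended_Real"
begin

definition geodesic :: "(real \<Rightarrow> 'a::metric_space) \<Rightarrow> bool" where
  "geodesic \<gamma> \<longleftrightarrow> (\<forall>s\<in>{0..1}. \<forall>t\<in>{0..1}.
      dist (\<gamma> s) (\<gamma> t) = \<bar>s - t\<bar> * dist (\<gamma> 0) (\<gamma> 1))"

definition hadamard_space :: "'a::metric_space itself \<Rightarrow> bool" where
  "hadamard_space _ \<longleftrightarrow>
     complete (UNIV :: 'a set) \<and>
     (\<forall>x y :: 'a. \<exists>\<gamma>. geodesic \<gamma> \<and> \<gamma> 0 = x \<and> \<gamma> 1 = y) \<and>
     (\<forall>(x::'a) \<gamma>. geodesic \<gamma> \<longrightarrow> (\<forall>t\<in>{0..1}.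
        (dist x (\<gamma> t))\<^sup>2 \<le> (1 - t) * (dist x (\<gamma> 0))\<^sup>2 + t * (dist x (\<gamma> 1))\<^sup>2
                             - t * (1 - t) * (dist (\<gamma> 0) (\<gamma> 1))\<^sup>2))"

definition geod_convex :: "('a::metric_space \<Rightarrow> ereal) \<Rightarrow> bool" where
  "geod_convex g \<longleftrightarrow> (\<forall>\<gamma>. geodesic \<gamma> \<longrightarrow>
     (\<forall>a\<in>{0..1}. \<forall>b\<in>{0..1}. \<forall>t\<in>{0..1}.
        g (\<gamma> ((1 - t) * a + t * b)) \<le> ereal (1 - t) * g (\<gamma> a) + ereal t * g (\<gamma> b)))"

definition lsc :: "('a::topological_space \<Rightarrow> ereal) \<Rightarrow> bool" where
  "lsc g \<longleftrightarrow> (\<forall>c. closed {x. g x \<le> c})"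

definition effdom :: "('a \<Rightarrow> ereal) \<Rightarrow> 'a set" where
  "effdom g = {x. g x < \<infinity>}"

definition resolvent :: "('a::metric_space \<Rightarrow> ereal) \<Rightarrow> real \<Rightarrow> 'a \<Rightarrow> 'a" where
  "resolvent g lam x = (if lam = 0 then x else
     (THE y. \<forall>z. g y + ereal ((dist x y)\<^sup>2 / (2 * lam)) \<le> g z + ereal ((dist x z)\<^sup>2 / (2 * lam))))"

definition semigroup :: "('a::metric_space \<Rightarrow> ereal) \<Rightarrow> real \<Rightarrow> 'a \<Rightarrow> 'a" where
  "semigroup g t x = lim (\<lambda>n. (resolvent g (t / real n) ^^ n) x)"

definition proj :: "'a::metric_space set \<Rightarrow> 'a \<Rightarrow> 'a" where
  "proj C x = (THE y. y \<in> C \<and> (\<forall>z\<in>C. dist x y \<le> dist x z))"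

fun comp_upto :: "nat \<Rightarrow> (nat \<Rightarrow> 'a \<Rightarrow> 'a) \<Rightarrow> 'a \<Rightarrow> 'a" where
  "comp_upto 0 F = id"
| "comp_upto (Suc j) F = F (Suc j) \<circ> comp_upto j F"

end

theory Submission
  imports Defs
begin

text \<open>
  A nonexpansive map \<open>F\<close> and \<open>\<mu>, \<rho> > 0\<close> define an implicit step \<open>R\<close>: the point \<open>R x\<close> is the fixed
  point of \<open>y \<mapsto> (1 - \<alpha>) x \<oplus> \<alpha> F y\<close> with \<open>\<alpha> = \<mu>/(\<mu> + \<rho>)\<close>. The distances between \<open>R\<^sup>i x\<close> and
  \<open>F\<^sup>j x\<close> satisfy Kobayashi's recursion, so convergence of the product formula \<open>(F\<^bsub>t/n\<^esub>)\<^sup>n x\<close>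
  reduces to convergence of the implicit steps of \<open>F\<^bsub>\<rho>\<^esub>\<close> to the resolvent of \<open>f\<close> as \<open>\<rho> \<rightarrow> 0\<close>. With
  \<open>F\<^bsub>\<rho>\<^esub>\<close> the resolvent of \<open>f\<close> itself, the same statement shows that \<open>S\<^sub>t\<close> exists.

  For the implicit step \<open>y\<close> of a composition with intermediate points \<open>y\<^sub>j\<close>, the variational
  inequalities of the factors add up to an upper bound of \<open>\<Sum> f\<^sub>j(y\<^sub>j) + d(x,y)\<^sup>2/2\<lambda>\<close> plus a penalty by
  the minimal value of \<open>f + d(x,\<cdot>)\<^sup>2/2\<lambda>\<close>. For resolvents the penalty is \<open>\<Sum> d(y\<^bsub>j-1\<^esub>,y\<^sub>j)\<^sup>2/2\<rho>\<close>: the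
  penalized functionals on tuples increase as \<open>\<rho> \<rightarrow> 0\<close> and are uniformly convex, so their almost
  minimizers form a Cauchy sequence, and no weak convergence is needed. For semigroups the penalty
  only controls the distances to the projections; there a bounded sublevel set of \<open>f\<^sub>l\<close> is compact by
  a Hopf-Rinow argument, and nonexpansiveness carries the convergence of one \<open>y\<^sub>l\<close> to all \<open>y\<^sub>j\<close>.
\<close>

section \<open>Geodesics and convex functions in Hadamard spaces\<close>

text \<open>Fixing one geodesic per pair turns the convex combination
  \<open>(1 - t) x \<oplus> t y\<close> into an operation, so that fixed-point maps and midpoints of
  tuples can be written down.\<close>

definition gp :: "'a::metric_space \<Rightarrow> 'a \<Rightarrow> real \<Rightarrow> 'a" where
  "gp x y = (SOME \<gamma>. geodesic \<gamma> \<and> \<gamma> 0 = x \<and> \<gamma> 1 = y)"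

definition nonexpansive :: "('a::metric_space \<Rightarrow> 'a) \<Rightarrow> bool" where
  "nonexpansive F \<longleftrightarrow> (\<forall>x y. dist (F x) (F y) \<le> dist x y)"

text \<open>An extended-real function \<open>g > -\<infinity>\<close> is handled as its domain \<open>D\<close> together with its real values
  \<open>G\<close> there; the values of \<open>G\<close> outside \<open>D\<close> are irrelevant.\<close>
definition convex_lsc :: "'a::metric_space set \<Rightarrow> ('a \<Rightarrow> real) \<Rightarrow> bool" where
  "convex_lsc D G \<longleftrightarrow> D \<noteq> {} \<and>
     (\<forall>x\<in>D. \<forall>y\<in>D. \<forall>t\<in>{0..1}. gp x y t \<in> D \<and> G (gp x y t) \<le> (1 - t) * G x + t * G y) \<and>
     (\<forall>u x a. (\<forall>n. u n \<in> D \<and> G (u n) \<le> a) \<and> u \<longlonglongrightarrow> x \<longrightarrow> x \<in> D \<and> G x \<le> a)"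

text \<open>With \<open>SOME\<close>, existence of a minimizer alone yields the minimizing property;
  uniqueness follows later from the variational inequality.\<close>

definition prox :: "'a::metric_space set \<Rightarrow> ('a \<Rightarrow> real) \<Rightarrow> real \<Rightarrow> 'a \<Rightarrow> 'a" where
  "prox D G lam x = (SOME y. y \<in> D \<and>
     (\<forall>z\<in>D. G y + (dist x y)\<^sup>2 / (2 * lam) \<le> G z + (dist x z)\<^sup>2 / (2 * lam)))"

locale hadamard =
  fixes T :: "'a::metric_space itself"
  assumes hadamard: "hadamard_space TYPE('a)"
begin

lemma complete_UNIV_hadamard: "complete (UNIV :: 'a set)"
  using hadamard unfolding hadamard_space_def by blast

lemma Cauchy_imp_limit:
  assumes "Cauchy (u :: nat \<Rightarrow> 'a)"
  obtains l where "u \<longlonglongrightarrow> l"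
  using complete_UNIV_hadamard assms unfolding complete_def by blast

lemma gp_geodesic:
  fixes x y :: 'a
  shows "geodesic (gp x y)" "gp x y 0 = x" "gp x y 1 = y"
proof -
  have "\<exists>\<gamma>. geodesic \<gamma> \<and> \<gamma> 0 = x \<and> \<gamma> 1 = y"
    using hadamard unfolding hadamard_space_def by blast
  from someI_ex[OF this] show "geodesic (gp x y)" "gp x y 0 = x" "gp x y 1 = y"
    unfolding gp_def by blast+
qed

lemma gp_cat0:
  fixes x y w :: 'a
  assumes "0 \<le> t" "t \<le> 1"
  shows "(dist w (gp x y t))\<^sup>2 \<le> (1 - t) * (dist w x)\<^sup>2 + t * (dist w y)\<^sup>2 - t * (1 - t) * (dist x y)\<^sup>2"
proof -
  have "\<forall>t\<in>{0..1}. (dist w (gp x y t))\<^sup>2 \<le> (1 - t) * (dist w (gp x y 0))\<^sup>2 + t * (dist w (gp x y 1))\<^sup>2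
                             - t * (1 - t) * (dist (gp x y 0) (gp x y 1))\<^sup>2"
    using hadamard gp_geodesic(1) unfolding hadamard_space_def by blast
  then show ?thesis using assms by (auto simp: gp_geodesic)
qed

section \<open>Comparison inequalities for geodesics\<close>

lemma dist_gp_left:
  fixes x y :: 'a
  assumes "0 \<le> t" "t \<le> 1"
  shows "dist x (gp x y t) = t * dist x y"
proof -
  have "dist (gp x y 0) (gp x y t) = \<bar>0 - t\<bar> * dist (gp x y 0) (gp x y 1)"
    using gp_geodesic(1)[of x y, unfolded geodesic_def, rule_format, of 0 t] assms by simp
  then show ?thesis using assms by (simp add: gp_geodesic)
qed

lemma dist_gp_right:
  fixes x y :: 'a
  assumes "0 \<le> t" "t \<le> 1"
  shows "dist y (gp x y t) = (1 - t) * dist x y"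
proof -
  have "dist (gp x y 1) (gp x y t) = \<bar>1 - t\<bar> * dist (gp x y 0) (gp x y 1)"
    using gp_geodesic(1)[of x y, unfolded geodesic_def, rule_format, of 1 t] assms by simp
  then show ?thesis using assms by (simp add: gp_geodesic)
qed

text \<open>The CAT(0) inequality is applied twice, first from the point \<open>p\<close> on one
  geodesic towards the other, then from \<open>v\<close> towards the geodesic that contains
  \<open>p\<close>; the mixed terms cancel.\<close>

lemma dist_gp_same_left:
  fixes x u v :: 'a
  assumes t: "0 \<le> t" "t \<le> 1"
  shows "dist (gp x u t) (gp x v t) \<le> t * dist u v"
proof -
  define p where "p = gp x u t"
  have px: "dist p x = t * dist x u"
    using dist_gp_left[OF t, of x u] by (simp add: p_def dist_commute)
  have 1: "(dist p (gp x v t))\<^sup>2 \<le> (1 - t) * (dist p x)\<^sup>2 + t * (dist p v)\<^sup>2 - t * (1 - t) * (dist x v)\<^sup>2"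
    using gp_cat0[OF t] .
  have "(dist p v)\<^sup>2 \<le> (1 - t) * (dist x v)\<^sup>2 + t * (dist u v)\<^sup>2 - t * (1 - t) * (dist x u)\<^sup>2"
    using gp_cat0[OF t, of v x u] by (simp add: p_def dist_commute)
  then have 2: "t * (dist p v)\<^sup>2 \<le> t * ((1 - t) * (dist x v)\<^sup>2 + t * (dist u v)\<^sup>2 - t * (1 - t) * (dist x u)\<^sup>2)"
    using t by (intro mult_left_mono)
  have "(1 - t) * (t * dist x u)\<^sup>2
      + t * ((1 - t) * (dist x v)\<^sup>2 + t * (dist u v)\<^sup>2 - t * (1 - t) * (dist x u)\<^sup>2)
      - t * (1 - t) * (dist x v)\<^sup>2 = (t * dist u v)\<^sup>2"
    by (simp add: power2_eq_square algebra_simps)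
  then have "(dist p (gp x v t))\<^sup>2 \<le> (t * dist u v)\<^sup>2"
    using 1 2 unfolding px by linarith
  then show ?thesis unfolding p_def
    using t by (meson power2_le_imp_le zero_le_dist mult_nonneg_nonneg)
qed

lemma dist_gp_same_right:
  fixes x y u :: 'a
  assumes t: "0 \<le> t" "t \<le> 1"
  shows "dist (gp x u t) (gp y u t) \<le> (1 - t) * dist x y"
proof -
  define p where "p = gp x u t"
  have pu: "dist p u = (1 - t) * dist x u"
    using dist_gp_right[OF t, of u x] by (simp add: p_def dist_commute)
  have 1: "(dist p (gp y u t))\<^sup>2 \<le> (1 - t) * (dist p y)\<^sup>2 + t * (dist p u)\<^sup>2 - t * (1 - t) * (dist y u)\<^sup>2"
    using gp_cat0[OF t] .
  have "(dist p y)\<^sup>2 \<le> (1 - t) * (dist x y)\<^sup>2 + t * (dist y u)\<^sup>2 - t * (1 - t) * (dist x u)\<^sup>2"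
    using gp_cat0[OF t, of y x u] by (simp add: p_def dist_commute)
  then have 2: "(1 - t) * (dist p y)\<^sup>2 \<le> (1 - t) * ((1 - t) * (dist x y)\<^sup>2 + t * (dist y u)\<^sup>2 - t * (1 - t) * (dist x u)\<^sup>2)"
    using t by (intro mult_left_mono) auto
  have "(1 - t) * ((1 - t) * (dist x y)\<^sup>2 + t * (dist y u)\<^sup>2 - t * (1 - t) * (dist x u)\<^sup>2)
      + t * ((1 - t) * dist x u)\<^sup>2 - t * (1 - t) * (dist y u)\<^sup>2 = ((1 - t) * dist x y)\<^sup>2"
    by (simp add: power2_eq_square algebra_simps)
  then have "(dist p (gp y u t))\<^sup>2 \<le> ((1 - t) * dist x y)\<^sup>2"
    using 1 2 unfolding pu by linarith
  then show ?thesis unfolding p_def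
    using t by (meson diff_ge_0_iff_ge power2_le_imp_le zero_le_dist mult_nonneg_nonneg)
qed

lemma dist_gp_gp:
  fixes x y u v :: 'a
  assumes "0 \<le> t" "t \<le> 1"
  shows "dist (gp x u t) (gp y v t) \<le> (1 - t) * dist x y + t * dist u v"
  using dist_gp_same_right[OF assms, of x u y] dist_gp_same_left[OF assms, of y u v]
    dist_triangle[of "gp x u t" "gp y v t" "gp y u t"] by linarith

lemma dist_midpoints_sq:
  fixes x y u v :: 'a
  shows "(dist (gp x u (1/2)) (gp y v (1/2)))\<^sup>2 \<le> ((dist x y)\<^sup>2 + (dist u v)\<^sup>2) / 2"
proof -
  have "dist (gp x u (1/2)) (gp y v (1/2)) \<le> (dist x y + dist u v) / 2"
    using dist_gp_gp[of "1/2" x u y v] by simp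
  then have "(dist (gp x u (1/2)) (gp y v (1/2)))\<^sup>2 \<le> ((dist x y + dist u v) / 2)\<^sup>2"
    by (intro power_mono) auto
  also have "\<dots> \<le> ((dist x y)\<^sup>2 + (dist u v)\<^sup>2) / 2"
    using zero_le_power2[of "dist x y - dist u v"] by (simp add: power2_eq_square field_simps)
  finally show ?thesis .
qed

text \<open>Both \<open>b\<close> and \<open>e\<close> are compared with the midpoint of the
  diagonal from \<open>a\<close> to \<open>c\<close>. This four-point inequality replaces the
  bilinearity of an inner product.\<close>

lemma quadrilateral:
  fixes a b c e :: 'a
  shows "(dist a c)\<^sup>2 + (dist b e)\<^sup>2 \<le> (dist a b)\<^sup>2 + (dist b c)\<^sup>2 + (dist c e)\<^sup>2 + (dist e a)\<^sup>2"
proof -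
  define m where "m = gp a c (1/2)"
  have 1: "(dist b m)\<^sup>2 \<le> (dist b a)\<^sup>2 / 2 + (dist b c)\<^sup>2 / 2 - (dist a c)\<^sup>2 / 4"
    using gp_cat0[of "1/2" b a c] by (simp add: m_def)
  have 2: "(dist e m)\<^sup>2 \<le> (dist e a)\<^sup>2 / 2 + (dist e c)\<^sup>2 / 2 - (dist a c)\<^sup>2 / 4"
    using gp_cat0[of "1/2" e a c] by (simp add: m_def)
  have "dist b e \<le> dist b m + dist e m" by (rule dist_triangle2)
  then have "(dist b e)\<^sup>2 \<le> (dist b m + dist e m)\<^sup>2" by (intro power_mono) auto
  also have "\<dots> \<le> 2 * (dist b m)\<^sup>2 + 2 * (dist e m)\<^sup>2"
    using zero_le_power2[of "dist b m - dist e m"] by (simp add: power2_eq_square algebra_simps)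
  finally show ?thesis using 1 2 by (simp add: dist_commute)
qed

section \<open>Limits and lower bounds of convex lower semicontinuous functions\<close>

lemma convex_lscD:
  assumes "convex_lsc D G"
  shows "D \<noteq> {}"
    and "\<And>x y t. x \<in> D \<Longrightarrow> y \<in> D \<Longrightarrow> 0 \<le> t \<Longrightarrow> t \<le> 1 \<Longrightarrow> gp x y t \<in> D"
    and "\<And>x y t. x \<in> D \<Longrightarrow> y \<in> D \<Longrightarrow> 0 \<le> t \<Longrightarrow> t \<le> 1 \<Longrightarrow> G (gp x y t) \<le> (1 - t) * G x + t * G y"
proof -
  have c: "\<forall>x\<in>D. \<forall>y\<in>D. \<forall>t\<in>{0..1}. gp x y t \<in> D \<and> G (gp x y t) \<le> (1 - t) * G x + t * G y"
    using assms unfolding convex_lsc_def by blast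
  show "gp x y t \<in> D" "G (gp x y t) \<le> (1 - t) * G x + t * G y"
    if "x \<in> D" "y \<in> D" "0 \<le> t" "t \<le> 1" for x y t
    using c that by auto
qed (use assms in \<open>simp add: convex_lsc_def\<close>)

lemma convex_lsc_frequently:
  fixes D :: "'a set"
  assumes "convex_lsc D G" "u \<longlonglongrightarrow> x"
    and fr: "\<exists>\<^sub>F n in sequentially. u n \<in> D \<and> G (u n) \<le> a"
  shows "x \<in> D \<and> G x \<le> a"
proof -
  have "infinite {n. u n \<in> D \<and> G (u n) \<le> a}"
    using fr by (simp add: frequently_cofinite[symmetric] cofinite_eq_sequentially)
  then obtain r :: "nat \<Rightarrow> nat" where r: "strict_mono r" "\<And>n. r n \<in> {n. u n \<in> D \<and> G (u n) \<le> a}"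
    using infinite_enumerate by blast
  have "(u \<circ> r) \<longlonglongrightarrow> x" using assms(2) r(1) by (rule LIMSEQ_subseq_LIMSEQ)
  moreover have "\<forall>n. (u \<circ> r) n \<in> D \<and> G ((u \<circ> r) n) \<le> a" using r(2) by auto
  ultimately show ?thesis using assms(1) unfolding convex_lsc_def by blast
qed

lemma convex_lsc_limit:
  fixes D :: "'a set"
  assumes c: "convex_lsc D G" "u \<longlonglongrightarrow> x"
    and ev: "\<forall>\<^sub>F n in sequentially. u n \<in> D \<and> G (u n) \<le> a n" and a: "a \<longlonglongrightarrow> l"
  shows "x \<in> D" "G x \<le> l"
proof -
  have *: "x \<in> D \<and> G x \<le> l + e" if "e > 0" for e
  proof (rule convex_lsc_frequently[OF c])
    have "\<forall>\<^sub>F n in sequentially. a n < l + e" using a that by (intro order_tendstoD(2)) auto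
    with ev have "\<forall>\<^sub>F n in sequentially. u n \<in> D \<and> G (u n) \<le> l + e" by eventually_elim auto
    then show "\<exists>\<^sub>F n in sequentially. u n \<in> D \<and> G (u n) \<le> l + e"
      by (intro eventually_frequently) auto
  qed
  from *[of 1] show "x \<in> D" by simp
  show "G x \<le> l" by (rule field_le_epsilon) (use * in blast)
qed

text \<open>Lower semicontinuity bounds \<open>G\<close> below on a small ball around a point of the
  domain. Convexity along the geodesic to a distant point turns this local bound into one that
  decreases at most linearly.\<close>

lemma convex_lsc_lower_bound:
  fixes D :: "'a set"
  assumes c: "convex_lsc D G"
  shows "\<exists>b c. c \<ge> 0 \<and> (\<forall>y\<in>D. b - c * dist w y \<le> G y)"
proof -
  obtain w' where w: "w' \<in> D" using convex_lscD(1)[OF c] by blast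
  have "\<exists>r>0. \<forall>y\<in>D. dist w' y < r \<longrightarrow> G w' - 1 \<le> G y"
  proof (rule ccontr)
    assume "\<not> ?thesis"
    then have "\<forall>n::nat. \<exists>y\<in>D. dist w' y < 1 / real (Suc n) \<and> G y < G w' - 1"
      by (metis not_le zero_less_divide_1_iff of_nat_0_less_iff zero_less_Suc)
    then obtain u where u: "\<And>n. u n \<in> D" "\<And>n. dist w' (u n) < 1 / real (Suc n)" "\<And>n. G (u n) < G w' - 1"
      by metis
    have "(\<lambda>n. 1 / real (Suc n)) \<longlonglongrightarrow> 0"
      using LIMSEQ_inverse_real_of_nat by (simp add: inverse_eq_divide)
    then have "(\<lambda>n. dist (u n) w') \<longlonglongrightarrow> 0"
      using u(2) by (intro tendsto_sandwich[OF _ _ tendsto_const, of 0 "\<lambda>n. dist (u n) w'"])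
        (auto simp: dist_commute intro!: always_eventually less_imp_le)
    then have "u \<longlonglongrightarrow> w'" using tendsto_dist_iff by blast
    then have "G w' \<le> G w' - 1"
      using convex_lsc_limit(2)[OF c, of u w' "\<lambda>_. G w' - 1" "G w' - 1"] u(1) less_imp_le[OF u(3)]
      by simp
    then show False by simp
  qed
  then obtain r where r: "r > 0" "\<And>y. y \<in> D \<Longrightarrow> dist w' y < r \<Longrightarrow> G w' - 1 \<le> G y" by blast
  have *: "G w' - 1 - 2 / r * dist w' y \<le> G y" if y: "y \<in> D" for y
  proof (cases "dist w' y < r")
    case True
    moreover have "0 \<le> 2 / r * dist w' y" using r(1) by simp
    ultimately show ?thesis using r(2)[OF y] by linarith
  next
    case False
    \<comment> \<open>Chosen so that the point at parameter \<open>t\<close> has distance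
      \<open>r / 2\<close> from \<open>w'\<close> and hence lies in the ball where the local bound
      holds.\<close>
    define t where "t = r / (2 * dist w' y)"
    have d: "dist w' y \<ge> r" "dist w' y > 0" using False r(1) by auto
    have t: "0 < t" "t \<le> 1" using r(1) d by (auto simp: t_def field_simps)
    have "dist w' (gp w' y t) = r / 2" using dist_gp_left[of t w' y] t d by (simp add: t_def)
    then have "G w' - 1 \<le> G (gp w' y t)"
      using r convex_lscD(2)[OF c w y] t by auto
    also have "\<dots> \<le> (1 - t) * G w' + t * G y" using convex_lscD(3)[OF c w y] t by auto
    finally have "- 1 \<le> t * (G y - G w')" by (simp add: algebra_simps)
    then have "- (1 / t) \<le> G y - G w'" using t by (simp add: field_simps)
    moreover have "1 / t = 2 / r * dist w' y" using r(1) d by (simp add: t_def field_simps)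
    ultimately show ?thesis by simp
  qed
  show ?thesis
  proof (intro exI conjI ballI)
    show "0 \<le> 2 / r" using r(1) by simp
    fix y assume "y \<in> D"
    have "2 / r * dist w' y \<le> 2 / r * (dist w w' + dist w y)"
      using r(1) by (intro mult_left_mono dist_triangle3) auto
    then show "G w' - 1 - 2 / r * dist w w' - 2 / r * dist w y \<le> G y"
      using *[OF \<open>y \<in> D\<close>] by (simp add: algebra_simps)
  qed
qed

end

text \<open>The infima \<open>W n\<close> increase and are bounded, so they converge. For
  \<open>n \<le> m\<close> monotonicity makes \<open>Z m\<close> an almost minimizer of
  \<open>\<Phi> n\<close> too, up to the gap \<open>V - W n\<close>. The midpoint of
  \<open>Z n\<close> and \<open>Z m\<close> cannot fall below \<open>W n\<close>, so uniform
  convexity forces their images under \<open>\<pi>\<close> together. Only these images are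
  controlled.\<close>

lemma almost_minimizers_Cauchy:
  fixes \<Phi> :: "nat \<Rightarrow> 'b \<Rightarrow> real" and \<pi> :: "'b \<Rightarrow> 'a::metric_space"
  assumes z0: "z0 \<in> Q" "\<And>n. \<Phi> n z0 \<le> U"
    and lower: "\<And>n z. z \<in> Q \<Longrightarrow> B \<le> \<Phi> n z"
    and mono: "\<And>n m z. n \<le> m \<Longrightarrow> z \<in> Q \<Longrightarrow> \<Phi> n z \<le> \<Phi> m z"
    and mid: "\<And>u v. u \<in> Q \<Longrightarrow> v \<in> Q \<Longrightarrow>
        \<exists>w\<in>Q. \<forall>n. \<Phi> n w + c * (dist (\<pi> u) (\<pi> v))\<^sup>2 \<le> (\<Phi> n u + \<Phi> n v) / 2"
    and c: "c > 0"
  shows "\<exists>V W Z. V \<le> U \<and> W \<longlonglongrightarrow> V \<and> (\<forall>n. \<forall>z\<in>Q. W n \<le> \<Phi> n z)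
    \<and> (\<forall>n. Z n \<in> Q) \<and> (\<lambda>n. \<Phi> n (Z n)) \<longlonglongrightarrow> V \<and> Cauchy (\<lambda>n. \<pi> (Z n))"
proof -
  define W where "W n = Inf (\<Phi> n ` Q)" for n
  have bdd: "bdd_below (\<Phi> n ` Q)" for n using lower by (intro bdd_belowI[of _ B]) auto
  have W_le: "W n \<le> \<Phi> n z" if "z \<in> Q" for n z
    unfolding W_def using that bdd by (intro cInf_lower) auto
  have W_U: "W n \<le> U" for n using W_le[OF z0(1)] z0(2) order_trans by blast
  have inc: "incseq W"
  proof (rule incseq_SucI)
    fix n
    show "W n \<le> W (Suc n)" unfolding W_def[of "Suc n"]
    proof (rule cInf_greatest)
      show "\<Phi> (Suc n) ` Q \<noteq> {}" using z0 by auto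
      show "W n \<le> y" if "y \<in> \<Phi> (Suc n) ` Q" for y
        using that W_le mono[of n "Suc n"] order_trans by fastforce
    qed
  qed
  obtain V where V: "W \<longlonglongrightarrow> V" "\<And>n. W n \<le> V" using incseq_convergent[OF inc] W_U by metis
  have VU: "V \<le> U" using V(1) W_U by (intro LIMSEQ_le_const2) auto
  have "\<exists>z\<in>Q. \<Phi> n z < W n + 1 / real (Suc n)" for n
    using cInf_lessD[of "\<Phi> n ` Q" "W n + 1 / real (Suc n)"] z0 unfolding W_def by auto
  then obtain Z where Z: "\<And>n. Z n \<in> Q" "\<And>n. \<Phi> n (Z n) < W n + 1 / real (Suc n)" by metis
  have null: "(\<lambda>n. 1 / real (Suc n)) \<longlonglongrightarrow> 0"
    using LIMSEQ_inverse_real_of_nat by (simp add: inverse_eq_divide)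
  have up: "(\<lambda>n. W n + 1 / real (Suc n)) \<longlonglongrightarrow> V" using tendsto_add[OF V(1) null] by simp
  have lim: "(\<lambda>n. \<Phi> n (Z n)) \<longlonglongrightarrow> V"
    using W_le Z by (intro tendsto_sandwich[OF _ _ V(1) up] always_eventually) (auto intro: less_imp_le)
  have key: "c * (dist (\<pi> (Z n)) (\<pi> (Z m)))\<^sup>2 \<le> V - W n + 1 / real (Suc n)" if "n \<le> m" for n m
  proof -
    obtain w where w: "w \<in> Q" "\<Phi> n w + c * (dist (\<pi> (Z n)) (\<pi> (Z m)))\<^sup>2 \<le> (\<Phi> n (Z n) + \<Phi> n (Z m)) / 2"
      using mid[OF Z(1) Z(1)] by blast
    have "1 / real (Suc m) \<le> 1 / real (Suc n)" using that by (simp add: frac_le)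
    then have "\<Phi> n (Z m) \<le> V + 1 / real (Suc n)"
      using mono[OF that Z(1), of m] Z(2)[of m] V(2)[of m] by linarith
    then show ?thesis using w(2) W_le[OF w(1), of n] Z(2)[of n] V(2)[of n] by argo
  qed
  have Cau: "Cauchy (\<lambda>n. \<pi> (Z n))"
  proof (rule metric_CauchyI)
    fix e :: real assume e: "e > 0"
    have "(\<lambda>n. V - W n + 1 / real (Suc n)) \<longlonglongrightarrow> V - V + 0" by (intro tendsto_intros V null)
    then have "\<forall>\<^sub>F n in sequentially. V - W n + 1 / real (Suc n) < c * (e/2)\<^sup>2"
      using e c by (intro order_tendstoD(2)[of _ 0]) auto
    then obtain N where N: "V - W N + 1 / real (Suc N) < c * (e/2)\<^sup>2"
      unfolding eventually_sequentially by blast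
    have near: "dist (\<pi> (Z N)) (\<pi> (Z m)) < e / 2" if "N \<le> m" for m
    proof -
      have "c * (dist (\<pi> (Z N)) (\<pi> (Z m)))\<^sup>2 < c * (e/2)\<^sup>2" using key[OF that] N by linarith
      then have "(dist (\<pi> (Z N)) (\<pi> (Z m)))\<^sup>2 < (e/2)\<^sup>2" using c by simp
      then show ?thesis by (rule power2_less_imp_less) (use e in simp)
    qed
    show "\<exists>M. \<forall>m\<ge>M. \<forall>n\<ge>M. dist (\<pi> (Z m)) (\<pi> (Z n)) < e"
    proof (intro exI allI impI)
      fix m n assume "m \<ge> N" "n \<ge> N"
      then show "dist (\<pi> (Z m)) (\<pi> (Z n)) < e"
        using near[of m] near[of n] dist_triangle3[of "\<pi> (Z m)" "\<pi> (Z n)" "\<pi> (Z N)"] by linarith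
    qed
  qed
  show ?thesis using VU V(1) W_le Z(1) lim Cau by blast
qed

section \<open>Resolvents\<close>

text \<open>Young's inequality; it absorbs linear lower bounds of the functions into squared
  distances.\<close>

lemma linear_le_quadratic:
  fixes c d lam :: real
  assumes "lam > 0"
  shows "c * d \<le> d\<^sup>2 / (2 * lam) + c\<^sup>2 * lam / 2"
proof -
  have "0 \<le> (d - c * lam)\<^sup>2 / (2 * lam)" using assms by simp
  also have "\<dots> = d\<^sup>2 / (2 * lam) + c\<^sup>2 * lam / 2 - c * d"
    using assms by (simp add: power2_eq_square field_simps)
  finally show ?thesis by simp
qed

lemma dist_sq_tendsto_zeroD:
  assumes "(\<lambda>n. (dist (u n) z)\<^sup>2) \<longlonglongrightarrow> 0"
  shows "u \<longlonglongrightarrow> z"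
proof -
  have "(\<lambda>n. sqrt ((dist (u n) z)\<^sup>2)) \<longlonglongrightarrow> sqrt 0" by (intro tendsto_real_sqrt assms)
  then have "(\<lambda>n. dist (u n) z) \<longlonglongrightarrow> 0" by simp
  then show ?thesis using tendsto_dist_iff by blast
qed

section \<open>Sums of functions; existence and nonexpansiveness of resolvents\<close>

context hadamard
begin

text \<open>The sequences may differ from summand to summand and share only the limit
  \<open>q\<close>. Near \<open>q\<close> every summand is bounded below, so the upper bound on the
  sum bounds each summand from above, which puts \<open>q\<close> into every domain. Lower
  semicontinuity of the summands then adds up.\<close>

lemma sum_lsc_limit:
  fixes Ds :: "'i \<Rightarrow> 'a set"
  assumes fin: "finite J" and c: "\<And>j. j \<in> J \<Longrightarrow> convex_lsc (Ds j) (Gs j)"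
    and u: "\<And>j. j \<in> J \<Longrightarrow> u j \<longlonglongrightarrow> q"
    and uD: "\<And>j. j \<in> J \<Longrightarrow> \<forall>\<^sub>F n in sequentially. u j n \<in> Ds j"
    and a: "\<forall>\<^sub>F n in sequentially. (\<Sum>j\<in>J. Gs j (u j n)) \<le> a n" "a \<longlonglongrightarrow> l"
  shows "\<And>j. j \<in> J \<Longrightarrow> q \<in> Ds j" "(\<Sum>j\<in>J. Gs j q) \<le> l"
proof -
  have "\<exists>b. \<forall>\<^sub>F n in sequentially. b \<le> Gs j (u j n)" if j: "j \<in> J" for j
  proof -
    obtain b c where bc: "c \<ge> 0" "\<And>y. y \<in> Ds j \<Longrightarrow> b - c * dist q y \<le> Gs j y"
      using convex_lsc_lower_bound[OF c[OF j], of q] by blast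
    have "\<forall>\<^sub>F n in sequentially. dist (u j n) q < 1" using tendstoD[OF u[OF j], of 1] by simp
    with uD[OF j] have "\<forall>\<^sub>F n in sequentially. b - c \<le> Gs j (u j n)"
    proof eventually_elim
      case (elim n)
      have "c * dist q (u j n) \<le> c * 1" using elim bc(1) by (intro mult_left_mono) (auto simp: dist_commute)
      then show ?case using bc(2)[OF elim(1)] by linarith
    qed
    then show ?thesis by blast
  qed
  then obtain b where b: "\<And>j. j \<in> J \<Longrightarrow> \<forall>\<^sub>F n in sequentially. b j \<le> Gs j (u j n)" by metis
  show qD: "q \<in> Ds i" if i: "i \<in> J" for i
  proof -
    have "\<forall>\<^sub>F n in sequentially. \<forall>j\<in>J. b j \<le> Gs j (u j n)"
      using b by (simp add: eventually_ball_finite[OF fin])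
    with a(1) uD[OF i] have "\<forall>\<^sub>F n in sequentially. u i n \<in> Ds i \<and> Gs i (u i n) \<le> a n - (\<Sum>j\<in>J - {i}. b j)"
    proof eventually_elim
      case (elim n)
      have "(\<Sum>j\<in>J - {i}. b j) \<le> (\<Sum>j\<in>J - {i}. Gs j (u j n))" using elim(3) by (intro sum_mono) auto
      then show ?case using elim(1,2) by (simp add: sum.remove[OF fin i])
    qed
    moreover have "(\<lambda>n. a n - (\<Sum>j\<in>J - {i}. b j)) \<longlonglongrightarrow> l - (\<Sum>j\<in>J - {i}. b j)"
      by (intro tendsto_intros a(2))
    ultimately show ?thesis by (rule convex_lsc_limit(1)[OF c[OF i] u[OF i]])
  qed
  show "(\<Sum>j\<in>J. Gs j q) \<le> l"
  proof (rule field_le_epsilon)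
    fix e :: real assume e: "e > 0"
    \<comment> \<open>The error is split among the summands; the \<open>+ 1\<close> keeps
      \<open>d\<close> positive for empty \<open>J\<close>.\<close>
    define d where "d = e / real (card J + 1)"
    have d: "d > 0" "real (card J) * d \<le> e" using e by (auto simp: d_def field_simps)
    have "\<forall>\<^sub>F n in sequentially. Gs j q - d \<le> Gs j (u j n)" if j: "j \<in> J" for j
    proof (rule ccontr)
      assume "\<not> ?thesis"
      then have "\<exists>\<^sub>F n in sequentially. \<not> Gs j q - d \<le> Gs j (u j n)"
        by (simp add: not_eventually)
      then have "\<exists>\<^sub>F n in sequentially. u j n \<in> Ds j \<and> \<not> Gs j q - d \<le> Gs j (u j n)"
        using uD[OF j] by (rule frequently_eventually_conj)
      then have "\<exists>\<^sub>F n in sequentially. u j n \<in> Ds j \<and> Gs j (u j n) \<le> Gs j q - d"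
        by (rule frequently_elim1) auto
      from convex_lsc_frequently[OF c[OF j] u[OF j] this] d show False by simp
    qed
    then have "\<forall>\<^sub>F n in sequentially. \<forall>j\<in>J. Gs j q - d \<le> Gs j (u j n)"
      by (simp add: eventually_ball_finite[OF fin])
    with a(1) have "\<forall>\<^sub>F n in sequentially. (\<Sum>j\<in>J. Gs j q) - real (card J) * d \<le> a n"
    proof eventually_elim
      case (elim n)
      have "(\<Sum>j\<in>J. Gs j q - d) \<le> (\<Sum>j\<in>J. Gs j (u j n))" using elim(2) by (intro sum_mono) auto
      then show ?case using elim(1) by (simp add: sum_subtractf)
    qed
    then have "(\<Sum>j\<in>J. Gs j q) - real (card J) * d \<le> l"
      using a(2) by (intro tendsto_lowerbound[of a l sequentially]) auto
    then show "(\<Sum>j\<in>J. Gs j q) \<le> l + e" using d by linarith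
  qed
qed

lemma convex_lsc_sum:
  fixes Ds :: "'i \<Rightarrow> 'a set"
  assumes fin: "finite J" and c: "\<And>j. j \<in> J \<Longrightarrow> convex_lsc (Ds j) (Gs j)"
    and ne: "(\<Inter>j\<in>J. Ds j) \<noteq> {}"
  shows "convex_lsc (\<Inter>j\<in>J. Ds j) (\<lambda>x. \<Sum>j\<in>J. Gs j x)"
  unfolding convex_lsc_def
proof (intro conjI ballI allI impI ne; (elim conjE)?)
  fix x y and t :: real
  assume xy: "x \<in> (\<Inter>j\<in>J. Ds j)" "y \<in> (\<Inter>j\<in>J. Ds j)" and t: "t \<in> {0..1}"
  show "gp x y t \<in> (\<Inter>j\<in>J. Ds j)" using xy t convex_lscD(2)[OF c] by auto
  have "(\<Sum>j\<in>J. Gs j (gp x y t)) \<le> (\<Sum>j\<in>J. (1 - t) * Gs j x + t * Gs j y)"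
    using xy t convex_lscD(3)[OF c] by (intro sum_mono) auto
  then show "(\<Sum>j\<in>J. Gs j (gp x y t)) \<le> (1 - t) * (\<Sum>j\<in>J. Gs j x) + t * (\<Sum>j\<in>J. Gs j y)"
    by (simp add: sum.distrib sum_distrib_left)
next
  fix u x a
  assume u: "\<forall>n. u n \<in> (\<Inter>j\<in>J. Ds j) \<and> (\<Sum>j\<in>J. Gs j (u n)) \<le> a" "u \<longlonglongrightarrow> x"
  note * = sum_lsc_limit[OF fin c, where u = "\<lambda>_. u" and q = x and a = "\<lambda>_. a" and l = a]
  show "x \<in> (\<Inter>j\<in>J. Ds j)" using u by (auto intro: *(1))
  show "(\<Sum>j\<in>J. Gs j x) \<le> a" by (rule *(2)) (use u in auto)
qed

text \<open>The direct method without weak topology: the CAT(0) inequality at midpoints makes the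
  functional uniformly convex with constant \<open>1 / (8 * lam)\<close>, so almost minimizers are
  Cauchy, and lower semicontinuity makes their limit a minimizer.\<close>

lemma prox_exists:
  fixes D :: "'a set"
  assumes c: "convex_lsc D G" and lam: "lam > 0"
  shows "\<exists>y\<in>D. \<forall>z\<in>D. G y + (dist x y)\<^sup>2 / (2 * lam) \<le> G z + (dist x z)\<^sup>2 / (2 * lam)"
proof -
  define \<Phi> where "\<Phi> z = G z + (dist x z)\<^sup>2 / (2 * lam)" for z
  obtain w where w: "w \<in> D" using convex_lscD(1)[OF c] by blast
  obtain b k where bk: "k \<ge> 0" "\<And>y. y \<in> D \<Longrightarrow> b - k * dist x y \<le> G y"
    using convex_lsc_lower_bound[OF c, of x] by blast
  have lower: "b - k\<^sup>2 * lam / 2 \<le> \<Phi> z" if "z \<in> D" for z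
    using bk(2)[OF that] linear_le_quadratic[OF lam, of k "dist x z"] unfolding \<Phi>_def by linarith
  have mid: "\<exists>w\<in>D. \<forall>n::nat. \<Phi> w + 1 / (8 * lam) * (dist u v)\<^sup>2 \<le> (\<Phi> u + \<Phi> v) / 2"
    if uv: "u \<in> D" "v \<in> D" for u v
  proof (intro bexI allI)
    show "gp u v (1/2) \<in> D" using convex_lscD(2)[OF c uv] by simp
    have "G (gp u v (1/2)) \<le> G u / 2 + G v / 2" using convex_lscD(3)[OF c uv, of "1/2"] by simp
    moreover have "(dist x (gp u v (1/2)))\<^sup>2 \<le> (dist x u)\<^sup>2 / 2 + (dist x v)\<^sup>2 / 2 - (dist u v)\<^sup>2 / 4"
      using gp_cat0[of "1/2" x u v] by simp
    then have "(dist x (gp u v (1/2)))\<^sup>2 / (2 * lam) \<le> ((dist x u)\<^sup>2 / 2 + (dist x v)\<^sup>2 / 2 - (dist u v)\<^sup>2 / 4) / (2 * lam)"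
      using lam by (intro divide_right_mono) auto
    then have "(dist x (gp u v (1/2)))\<^sup>2 / (2 * lam)
        \<le> ((dist x u)\<^sup>2 / (2 * lam) + (dist x v)\<^sup>2 / (2 * lam)) / 2 - 1 / (8 * lam) * (dist u v)\<^sup>2"
      using lam by (simp add: add_divide_distrib diff_divide_distrib)
    moreover have "a + d + r \<le> (gu + eu + (gv + ev)) / 2"
      if "a \<le> gu / 2 + gv / 2" "d \<le> (eu + ev) / 2 - r" for a d r gu eu gv ev :: real
      using that by argo
    ultimately show "\<Phi> (gp u v (1/2)) + 1 / (8 * lam) * (dist u v)\<^sup>2 \<le> (\<Phi> u + \<Phi> v) / 2"
      unfolding \<Phi>_def by blast
  qed
  have "\<exists>V W Z. V \<le> \<Phi> w \<and> W \<longlonglongrightarrow> V \<and> (\<forall>n::nat. \<forall>z\<in>D. W n \<le> \<Phi> z)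
    \<and> (\<forall>n. Z n \<in> D) \<and> (\<lambda>n. \<Phi> (Z n)) \<longlonglongrightarrow> V \<and> Cauchy (\<lambda>n. Z n)"
    using lam by (intro almost_minimizers_Cauchy[OF w _ lower _ mid]) auto
  then obtain V W Z where Z: "W \<longlonglongrightarrow> V" "\<And>n z. z \<in> D \<Longrightarrow> W n \<le> \<Phi> z" "\<And>n. Z n \<in> D"
      "(\<lambda>n. \<Phi> (Z n)) \<longlonglongrightarrow> V" "Cauchy Z" by blast
  obtain q where q: "Z \<longlonglongrightarrow> q" using Z(5) by (rule Cauchy_imp_limit)
  have "(\<lambda>n. \<Phi> (Z n) - (dist x (Z n))\<^sup>2 / (2 * lam)) \<longlonglongrightarrow> V - (dist x q)\<^sup>2 / (2 * lam)"
    using lam by (intro tendsto_intros Z q) auto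
  from convex_lsc_limit[OF c q _ this] have "q \<in> D" "G q \<le> V - (dist x q)\<^sup>2 / (2 * lam)"
    using Z(3) by (auto simp: \<Phi>_def)
  moreover have "V \<le> \<Phi> z" if "z \<in> D" for z
    using Z(1) Z(2)[OF that] by (intro LIMSEQ_le_const2) auto
  ultimately show ?thesis unfolding \<Phi>_def by (intro bexI[of _ q] ballI) fastforce
qed

lemma prox_mem:
  fixes D :: "'a set"
  assumes "convex_lsc D G" "lam > 0"
  shows "prox D G lam x \<in> D"
  using someI_ex[of "\<lambda>y. y \<in> D \<and> (\<forall>z\<in>D. G y + (dist x y)\<^sup>2 / (2 * lam) \<le> G z + (dist x z)\<^sup>2 / (2 * lam))"]
    prox_exists[OF assms, of x] unfolding prox_def by blast

text \<open>The discrete evolution variational inequality: the minimizer \<open>y\<close> is tested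
  against \<open>gp y z t\<close>, the result is divided by \<open>t\<close>, and \<open>t\<close>
  tends to 0.\<close>

lemma minimizer_evi:
  fixes D :: "'a set"
  assumes c: "convex_lsc D G" and lam: "lam > 0" and y: "y \<in> D"
    and min: "\<And>z. z \<in> D \<Longrightarrow> G y + (dist x y)\<^sup>2 / (2 * lam) \<le> G z + (dist x z)\<^sup>2 / (2 * lam)"
    and z: "z \<in> D"
  shows "(dist y z)\<^sup>2 + (dist x y)\<^sup>2 \<le> (dist x z)\<^sup>2 + 2 * lam * (G z - G y)"
proof -
  have *: "(1 - t) * (dist y z)\<^sup>2 + (dist x y)\<^sup>2 \<le> (dist x z)\<^sup>2 + 2 * lam * (G z - G y)"
    if t: "0 < t" "t \<le> 1" for t
  proof -
    have G: "G (gp y z t) \<le> (1 - t) * G y + t * G z"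
      using convex_lscD(3)[OF c y z] t by simp
    have d: "(dist x (gp y z t))\<^sup>2 \<le> (1 - t) * (dist x y)\<^sup>2 + t * (dist x z)\<^sup>2 - t * (1 - t) * (dist y z)\<^sup>2"
      using gp_cat0[of t x y z] t by simp
    have "G y + (dist x y)\<^sup>2 / (2 * lam) \<le> G (gp y z t) + (dist x (gp y z t))\<^sup>2 / (2 * lam)"
      using min convex_lscD(2)[OF c y z] t by simp
    then have "2 * lam * (G y + (dist x y)\<^sup>2 / (2 * lam)) \<le> 2 * lam * (G (gp y z t) + (dist x (gp y z t))\<^sup>2 / (2 * lam))"
      using lam by (intro mult_left_mono) auto
    then have "2 * lam * G y + (dist x y)\<^sup>2 \<le> 2 * lam * G (gp y z t) + (dist x (gp y z t))\<^sup>2"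
      using lam by (simp add: distrib_left)
    also have "\<dots> \<le> 2 * lam * ((1 - t) * G y + t * G z)
        + ((1 - t) * (dist x y)\<^sup>2 + t * (dist x z)\<^sup>2 - t * (1 - t) * (dist y z)\<^sup>2)"
      using lam G d by (intro add_mono mult_left_mono) auto
    finally have "t * ((1 - t) * (dist y z)\<^sup>2 + (dist x y)\<^sup>2) \<le> t * ((dist x z)\<^sup>2 + 2 * lam * (G z - G y))"
      by (simp add: algebra_simps)
    then show ?thesis using t by simp
  qed
  have "((\<lambda>t. (1 - t) * (dist y z)\<^sup>2 + (dist x y)\<^sup>2) \<longlongrightarrow> (1 - 0) * (dist y z)\<^sup>2 + (dist x y)\<^sup>2) (at_right 0)"
    by (intro tendsto_intros)
  moreover have "\<forall>\<^sub>F t in at_right 0. (1 - t) * (dist y z)\<^sup>2 + (dist x y)\<^sup>2 \<le> (dist x z)\<^sup>2 + 2 * lam * (G z - G y)"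
    by (rule eventually_mono[OF eventually_at_right_real[of 0 1]]) (auto intro!: *)
  ultimately have "(1 - 0) * (dist y z)\<^sup>2 + (dist x y)\<^sup>2 \<le> (dist x z)\<^sup>2 + 2 * lam * (G z - G y)"
    by (rule tendsto_upperbound) simp
  then show ?thesis by simp
qed

lemma prox_evi:
  fixes D :: "'a set"
  assumes "convex_lsc D G" "lam > 0" "z \<in> D"
  shows "(dist (prox D G lam x) z)\<^sup>2 + (dist x (prox D G lam x))\<^sup>2
    \<le> (dist x z)\<^sup>2 + 2 * lam * (G z - G (prox D G lam x))"
proof (rule minimizer_evi[OF assms(1,2) prox_mem[OF assms(1,2)] _ assms(3)])
  fix z assume "z \<in> D"
  then show "G (prox D G lam x) + (dist x (prox D G lam x))\<^sup>2 / (2 * lam) \<le> G z + (dist x z)\<^sup>2 / (2 * lam)"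
    using someI_ex[of "\<lambda>y. y \<in> D \<and> (\<forall>z\<in>D. G y + (dist x y)\<^sup>2 / (2 * lam) \<le> G z + (dist x z)\<^sup>2 / (2 * lam))"]
      prox_exists[OF assms(1,2), of x] unfolding prox_def by blast
qed

text \<open>Each of two minimizers serves as test point in the variational inequality of the other;
  the values of \<open>G\<close> cancel in the sum and only their distance remains.\<close>

lemma minimizer_eq_prox:
  fixes D :: "'a set"
  assumes c: "convex_lsc D G" and lam: "lam > 0" and y: "y \<in> D"
    and min: "\<And>z. z \<in> D \<Longrightarrow> G y + (dist x y)\<^sup>2 / (2 * lam) \<le> G z + (dist x z)\<^sup>2 / (2 * lam)"
  shows "y = prox D G lam x"
proof -
  let ?p = "prox D G lam x"
  have "(dist y ?p)\<^sup>2 + (dist x y)\<^sup>2 \<le> (dist x ?p)\<^sup>2 + 2 * lam * (G ?p - G y)"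
    by (rule minimizer_evi[OF c lam y min prox_mem[OF c lam]])
  moreover have "(dist ?p y)\<^sup>2 + (dist x ?p)\<^sup>2 \<le> (dist x y)\<^sup>2 + 2 * lam * (G y - G ?p)"
    by (rule prox_evi[OF c lam y])
  ultimately have "(dist y ?p)\<^sup>2 \<le> 0"
    unfolding right_diff_distrib dist_commute[of ?p y] by linarith
  then show ?thesis by simp
qed

text \<open>In the sum of the two variational inequalities the values of \<open>G\<close> cancel,
  and \<open>quadrilateral\<close> bounds the cross distances.\<close>

lemma nonexpansive_prox:
  fixes D :: "'a set"
  assumes c: "convex_lsc D G" and lam: "lam > 0"
  shows "nonexpansive (prox D G lam)"
  unfolding nonexpansive_def
proof (intro allI)
  fix x x' :: 'a
  define y y' where "y = prox D G lam x" and "y' = prox D G lam x'"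
  have D: "y \<in> D" "y' \<in> D" using prox_mem[OF c lam] by (auto simp: y_def y'_def)
  have "(dist y y')\<^sup>2 + (dist x y)\<^sup>2 \<le> (dist x y')\<^sup>2 + 2 * lam * (G y' - G y)"
    using prox_evi[OF c lam D(2)] by (simp add: y_def)
  moreover have "(dist y' y)\<^sup>2 + (dist x' y')\<^sup>2 \<le> (dist x' y)\<^sup>2 + 2 * lam * (G y - G y')"
    using prox_evi[OF c lam D(1)] by (simp add: y'_def)
  moreover have "(dist x y')\<^sup>2 + (dist y x')\<^sup>2 \<le> (dist x y)\<^sup>2 + (dist y y')\<^sup>2 + (dist y' x')\<^sup>2 + (dist x' x)\<^sup>2"
    by (rule quadrilateral)
  ultimately have "(dist y y')\<^sup>2 \<le> (dist x x')\<^sup>2"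
    unfolding right_diff_distrib dist_commute[of y' y] dist_commute[of y x'] dist_commute[of y' x']
      dist_commute[of x' x] by linarith
  then show "dist (prox D G lam x) (prox D G lam x') \<le> dist x x'"
    unfolding y_def y'_def by (rule power2_le_imp_le) simp
qed

text \<open>The linear lower bound of \<open>G\<close> controls the right-hand side of
  \<open>evi\<close> up to a term linear in the unknown distance; absorbing that term leaves a bound
  that vanishes with \<open>rho\<close>.\<close>

lemma evi_tendsto:
  fixes D :: "'a set"
  assumes c: "convex_lsc D G" and z: "z \<in> D" and rho: "rho \<longlonglongrightarrow> 0" "\<And>n. n \<ge> (1::nat) \<Longrightarrow> rho n > 0"
    and v: "\<And>n. n \<ge> 1 \<Longrightarrow> v n \<in> D"
    and evi: "\<And>n. n \<ge> 1 \<Longrightarrow> (dist (v n) z)\<^sup>2 \<le> 2 * rho n * (G z - G (v n))"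
  shows "v \<longlonglongrightarrow> z"
proof (rule dist_sq_tendsto_zeroD)
  obtain b c where bc: "c \<ge> 0" "\<And>y. y \<in> D \<Longrightarrow> b - c * dist z y \<le> G y"
    using convex_lsc_lower_bound[OF c, of z] by blast
  have *: "(dist (v n) z)\<^sup>2 \<le> 4 * rho n * (G z - b) + 4 * c\<^sup>2 * (rho n)\<^sup>2" if n: "n \<ge> 1" for n
  proof -
    have "(dist (v n) z)\<^sup>2 \<le> 2 * rho n * (G z - G (v n))" using evi[OF n] .
    also have "\<dots> \<le> 2 * rho n * (G z - b + c * dist (v n) z)"
      using bc(2)[OF v[OF n]] rho(2)[OF n] by (intro mult_left_mono) (auto simp: dist_commute)
    also have "\<dots> = 2 * rho n * (G z - b) + (2 * rho n * c) * dist (v n) z" by (simp add: algebra_simps)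
    \<comment> \<open>Young's inequality with parameter 1 leaves half of the squared distance, which
      moves to the left-hand side.\<close>
    also have "\<dots> \<le> 2 * rho n * (G z - b) + ((dist (v n) z)\<^sup>2 / (2 * 1) + (2 * rho n * c)\<^sup>2 * 1 / 2)"
      by (intro add_left_mono linear_le_quadratic) simp
    finally show ?thesis by (simp add: power_mult_distrib algebra_simps)
  qed
  have "(\<lambda>n. 4 * rho n * (G z - b) + 4 * c\<^sup>2 * (rho n)\<^sup>2) \<longlonglongrightarrow> 4 * 0 * (G z - b) + 4 * c\<^sup>2 * 0\<^sup>2"
    by (intro tendsto_intros rho)
  then have "(\<lambda>n. 4 * rho n * (G z - b) + 4 * c\<^sup>2 * (rho n)\<^sup>2) \<longlonglongrightarrow> 0" by simp
  then show "(\<lambda>n. (dist (v n) z)\<^sup>2) \<longlonglongrightarrow> 0"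
    by (rule tendsto_sandwich[OF _ _ tendsto_const, rotated 2])
      (auto intro!: * eventually_sequentiallyI[of 1])
qed

text \<open>Points of the closure are approximated from \<open>D\<close>, where the variational
  inequality is available. Nonexpansiveness is asked for on \<open>closure D\<close> only, so that
  the lemma applies to flows as well as to resolvents.\<close>

lemma nonexpansive_evi_tendsto:
  fixes D :: "'a set"
  assumes c: "convex_lsc D G" and q: "q \<in> closure D"
    and rho: "rho \<longlonglongrightarrow> 0" "\<And>n. n \<ge> (1::nat) \<Longrightarrow> rho n > 0"
    and F: "\<And>n x y. n \<ge> 1 \<Longrightarrow> x \<in> closure D \<Longrightarrow> y \<in> closure D \<Longrightarrow> dist (F n x) (F n y) \<le> dist x y"
    and v: "\<And>n z. n \<ge> 1 \<Longrightarrow> z \<in> D \<Longrightarrow> F n z \<in> D"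
    and evi: "\<And>n z. n \<ge> 1 \<Longrightarrow> z \<in> D \<Longrightarrow> (dist (F n z) z)\<^sup>2 \<le> 2 * rho n * (G z - G (F n z))"
  shows "(\<lambda>n. F n q) \<longlonglongrightarrow> q"
proof (rule tendstoI)
  fix e :: real assume e: "e > 0"
  obtain z where z: "z \<in> D" "dist z q < e / 3"
    using q e unfolding closure_approachable by (meson zero_less_divide_iff zero_less_numeral)
  have "(\<lambda>n. F n z) \<longlonglongrightarrow> z" using evi_tendsto[OF c z(1) rho v evi] z(1) by blast
  then have "\<forall>\<^sub>F n in sequentially. dist (F n z) z < e / 3" using e by (intro tendstoD) auto
  with eventually_ge_at_top[of 1] show "\<forall>\<^sub>F n in sequentially. dist (F n q) q < e"
  proof eventually_elim
    case (elim n)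
    have "dist (F n q) (F n z) \<le> dist q z" using F elim q z(1) closure_subset by blast
    moreover have "dist (F n q) q \<le> dist (F n q) (F n z) + dist (F n z) z + dist z q"
      using dist_triangle[of "F n q" q "F n z"] dist_triangle[of "F n z" q z] by linarith
    ultimately show ?case using elim z(2) by (simp add: dist_commute)
  qed
qed

lemma prox_tendsto:
  fixes D :: "'a set"
  assumes c: "convex_lsc D G" and q: "q \<in> closure D"
    and rho: "rho \<longlonglongrightarrow> 0" "\<And>n. n \<ge> (1::nat) \<Longrightarrow> rho n > 0"
  shows "(\<lambda>n. prox D G (rho n) q) \<longlonglongrightarrow> q"
proof (rule nonexpansive_evi_tendsto[OF c q rho])
  fix n :: nat and x y assume "n \<ge> 1"
  then show "dist (prox D G (rho n) x) (prox D G (rho n) y) \<le> dist x y"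
    using nonexpansive_prox[OF c] rho(2) unfolding nonexpansive_def by blast
next
  fix n :: nat and z assume n: "n \<ge> 1" and z: "z \<in> D"
  show "prox D G (rho n) z \<in> D" using prox_mem[OF c] rho(2)[OF n] by blast
  show "(dist (prox D G (rho n) z) z)\<^sup>2 \<le> 2 * rho n * (G z - G (prox D G (rho n) z))"
    using prox_evi[OF c rho(2)[OF n] z, of z] zero_le_power2[of "dist z (prox D G (rho n) z)"]
    unfolding dist_self zero_power2 by linarith
qed

end

section \<open>A Chernoff-type theorem\<close>

text \<open>With \<open>\<alpha> = \<mu>/(\<mu> + \<rho>)\<close> this is the resolvent with step \<open>\<mu>\<close> of the operator \<open>(I - F)/\<rho>\<close>.\<close>
definition ires :: "('a::metric_space \<Rightarrow> 'a) \<Rightarrow> real \<Rightarrow> 'a \<Rightarrow> 'a" where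
  "ires F \<alpha> x = (SOME y. gp x (F y) \<alpha> = y)"

lemma nonexpansiveD: "nonexpansive F \<Longrightarrow> dist (F x) (F y) \<le> dist x y"
  unfolding nonexpansive_def by blast

lemma nonexpansive_funpow:
  assumes "nonexpansive F"
  shows "nonexpansive (F ^^ n)"
proof (induction n)
  case (Suc n)
  then show ?case using assms unfolding nonexpansive_def by simp (meson order_trans)
qed (simp add: nonexpansive_def)

lemma dist_funpow_le:
  assumes F: "nonexpansive F" and x: "dist x (F x) \<le> c"
  shows "dist ((F ^^ n) x) x \<le> real n * c"
proof (induction n)
  case (Suc n)
  have "dist ((F ^^ Suc n) x) x \<le> dist ((F ^^ n) (F x)) ((F ^^ n) x) + dist ((F ^^ n) x) x"
    by (metis dist_triangle funpow_swap1 funpow.simps(2) o_apply)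
  also have "\<dots> \<le> c + real n * c"
    using Suc nonexpansiveD[OF nonexpansive_funpow[OF F], of n "F x" x] x by (simp add: dist_commute)
  finally show ?case by (simp add: algebra_simps)
qed simp

section \<open>Implicit steps of a nonexpansive map\<close>

context hadamard
begin

text \<open>The defining map is a contraction with factor \<open>\<alpha>\<close>, so Banach's
  theorem provides the fixed point.\<close>

lemma ires_eq:
  fixes F :: "'a \<Rightarrow> 'a"
  assumes F: "nonexpansive F" and a: "0 \<le> \<alpha>" "\<alpha> < 1"
  shows "gp x (F (ires F \<alpha> x)) \<alpha> = ires F \<alpha> x"
proof -
  have "\<exists>!y\<in>UNIV. gp x (F y) \<alpha> = y"
  proof (rule Banach_fix[OF complete_UNIV_hadamard _ a])
    fix y z :: 'a
    have "dist (gp x (F y) \<alpha>) (gp x (F z) \<alpha>) \<le> \<alpha> * dist (F y) (F z)"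
      using dist_gp_same_left a by simp
    also have "\<dots> \<le> \<alpha> * dist y z" using a nonexpansiveD[OF F] by (intro mult_left_mono) auto
    finally show "dist (gp x (F y) \<alpha>) (gp x (F z) \<alpha>) \<le> \<alpha> * dist y z" .
  qed auto
  then have "\<exists>y. gp x (F y) \<alpha> = y" by blast
  then show ?thesis unfolding ires_def by (rule someI_ex)
qed

lemma nonexpansive_ires:
  fixes F :: "'a \<Rightarrow> 'a"
  assumes F: "nonexpansive F" and a: "0 \<le> \<alpha>" "\<alpha> < 1"
  shows "nonexpansive (ires F \<alpha>)"
  unfolding nonexpansive_def
proof (intro allI)
  fix x x'
  let ?y = "ires F \<alpha> x" and ?y' = "ires F \<alpha> x'"
  have "dist ?y ?y' = dist (gp x (F ?y) \<alpha>) (gp x' (F ?y') \<alpha>)" using ires_eq[OF assms] by simp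
  also have "\<dots> \<le> (1 - \<alpha>) * dist x x' + \<alpha> * dist (F ?y) (F ?y')" using dist_gp_gp a by simp
  also have "\<dots> \<le> (1 - \<alpha>) * dist x x' + \<alpha> * dist ?y ?y'"
    using a nonexpansiveD[OF F] by (intro add_left_mono mult_left_mono) auto
  finally have "(1 - \<alpha>) * dist ?y ?y' \<le> (1 - \<alpha>) * dist x x'" by (simp add: algebra_simps)
  then show "dist ?y ?y' \<le> dist x x'" using a by simp
qed

text \<open>The point \<open>y\<close> divides the geodesic from \<open>x\<close> to
  \<open>F y\<close> in the ratio \<open>\<mu> : \<rho>\<close>. The first claim turns a bound on
  \<open>dist x y\<close> into a speed bound for \<open>F\<close> at \<open>y\<close>; the second
  says that an implicit step starts no faster than \<open>F\<close> does.\<close>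

lemma ires_dist:
  fixes F :: "'a \<Rightarrow> 'a" and x :: 'a
  assumes F: "nonexpansive F" and pos: "\<mu> > 0" "\<rho> > 0"
  defines "y \<equiv> ires F (\<mu> / (\<mu> + \<rho>)) x"
  shows "\<mu> * dist y (F y) = \<rho> * dist x y"
    and "\<rho> * dist x y \<le> \<mu> * dist x (F x)"
proof -
  define a where "a = \<mu> / (\<mu> + \<rho>)"
  have a: "0 \<le> a" "a < 1" using pos by (auto simp: a_def)
  have y: "gp x (F y) a = y" unfolding y_def a_def using ires_eq[OF F] pos by simp
  have d: "dist x y = a * dist x (F y)" "dist (F y) y = (1 - a) * dist x (F y)"
    using dist_gp_left[of a x "F y"] dist_gp_right[of a "F y" x] a y by auto
  have e: "\<mu> * (1 - a) = \<rho> * a" "\<mu> + \<rho> \<noteq> 0" using pos by (auto simp: a_def field_simps)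
  show 1: "\<mu> * dist y (F y) = \<rho> * dist x y"
    using d e(1) by (metis dist_commute mult.assoc)
  have "dist x (F y) \<le> dist x (F x) + dist x y"
    using dist_triangle[of x "F y" "F x"] nonexpansiveD[OF F, of x y] by linarith
  moreover have "(\<mu> + \<rho>) * dist x y = \<mu> * dist x (F y)" using d(1) e(2) by (simp add: a_def)
  moreover have "\<mu> * dist x (F y) \<le> \<mu> * (dist x (F x) + dist x y)"
    using calculation(1) pos by (intro mult_left_mono) auto
  ultimately show "\<rho> * dist x y \<le> \<mu> * dist x (F x)" by (simp add: algebra_simps)
qed

text \<open>The weights \<open>\<rho>/(\<mu>+\<rho>)\<close> and \<open>\<mu>/(\<mu>+\<rho>)\<close> reproduce the right-hand side exactly, which is
  what makes the double induction of Kobayashi close.\<close>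
lemma ires_funpow_dist:
  fixes F :: "'a \<Rightarrow> 'a"
  assumes F: "nonexpansive F" and pos: "\<mu> > 0" "\<rho> > 0"
    and L: "dist x (F x) \<le> L * \<rho>"
  shows "(dist ((ires F (\<mu> / (\<mu> + \<rho>)) ^^ i) x) ((F ^^ j) x))\<^sup>2
    \<le> L\<^sup>2 * ((real i * \<mu> - real j * \<rho>)\<^sup>2 + real i * \<mu>\<^sup>2 + real j * \<rho>\<^sup>2)"
proof -
  define a where "a = \<mu> / (\<mu> + \<rho>)"
  define R where "R = ires F a"
  have a: "0 \<le> a" "a < 1" using pos by (auto simp: a_def)
  have R: "nonexpansive R" unfolding R_def using nonexpansive_ires[OF F a] .
  have "\<rho> * dist x (R x) \<le> \<mu> * dist x (F x)" using ires_dist(2)[OF F pos] by (simp add: R_def a_def)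
  also have "\<dots> \<le> \<mu> * (L * \<rho>)" using L pos by (intro mult_left_mono) auto
  finally have xR: "dist x (R x) \<le> L * \<mu>" using pos by (simp add: algebra_simps)
  define B where "B i j = (real i * \<mu> - real j * \<rho>)\<^sup>2 + real i * \<mu>\<^sup>2 + real j * \<rho>\<^sup>2" for i j
  have rec: "(1 - a) * B i (Suc j) + a * B (Suc i) j = B (Suc i) (Suc j)" for i j
  proof -
    have "(\<mu> + \<rho>) * (1 - a) = \<rho>" "(\<mu> + \<rho>) * a = \<mu>" using pos by (auto simp: a_def field_simps)
    then have "(\<mu> + \<rho>) * ((1 - a) * B i (Suc j) + a * B (Suc i) j) = \<rho> * B i (Suc j) + \<mu> * B (Suc i) j"
      by (metis distrib_left mult.assoc)
    also have "\<dots> = (\<mu> + \<rho>) * B (Suc i) (Suc j)"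
      unfolding B_def by (simp add: power2_eq_square algebra_simps)
    finally show ?thesis using pos by simp
  qed
  have "(dist ((R ^^ i) x) ((F ^^ j) x))\<^sup>2 \<le> L\<^sup>2 * B i j"
  proof (induction i arbitrary: j)
    case 0
    have "dist ((R ^^ 0) x) ((F ^^ j) x) \<le> real j * (L * \<rho>)"
      using dist_funpow_le[OF F L, of j] by (simp add: dist_commute)
    then have "(dist ((R ^^ 0) x) ((F ^^ j) x))\<^sup>2 \<le> (real j * (L * \<rho>))\<^sup>2" by (intro power_mono) auto
    also have "\<dots> = L\<^sup>2 * (real j * \<rho>)\<^sup>2" by (simp add: power_mult_distrib)
    also have "\<dots> \<le> L\<^sup>2 * B 0 j" unfolding B_def by (intro mult_left_mono) auto
    finally show ?case .
  next
    case (Suc i)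
    note IHi = Suc
    show ?case
    proof (induction j)
      case 0
      have "dist ((R ^^ Suc i) x) ((F ^^ 0) x) \<le> real (Suc i) * (L * \<mu>)"
        using dist_funpow_le[OF R xR, of "Suc i"] by simp
      then have "(dist ((R ^^ Suc i) x) ((F ^^ 0) x))\<^sup>2 \<le> (real (Suc i) * (L * \<mu>))\<^sup>2"
        by (intro power_mono) auto
      also have "\<dots> = L\<^sup>2 * (real (Suc i) * \<mu>)\<^sup>2" by (simp add: power_mult_distrib)
      also have "\<dots> \<le> L\<^sup>2 * B (Suc i) 0" unfolding B_def by (intro mult_left_mono) auto
      finally show ?case .
    next
      case (Suc j)
      let ?y = "(R ^^ Suc i) x" and ?z = "(F ^^ Suc j) x"
      \<comment> \<open>The new implicit iterate lies on the geodesic from the old one to its image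
        under \<open>F\<close>. The CAT(0) inequality, with one application of \<open>F\<close>
        removed by nonexpansiveness, leads back to the index pairs \<open>(i, Suc j)\<close> and
        \<open>(Suc i, j)\<close>.\<close>
      have y: "?y = gp ((R ^^ i) x) (F ?y) a" using ires_eq[OF F a] by (simp add: R_def)
      have "(dist ?y ?z)\<^sup>2 = (dist ?z (gp ((R ^^ i) x) (F ?y) a))\<^sup>2" using y by (metis dist_commute)
      also have "\<dots> \<le> (1 - a) * (dist ?z ((R ^^ i) x))\<^sup>2 + a * (dist ?z (F ?y))\<^sup>2
          - a * (1 - a) * (dist ((R ^^ i) x) (F ?y))\<^sup>2"
        using gp_cat0 a by simp
      also have "\<dots> \<le> (1 - a) * (dist ?z ((R ^^ i) x))\<^sup>2 + a * (dist ?z (F ?y))\<^sup>2"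
        using a by simp
      also have "\<dots> \<le> (1 - a) * (L\<^sup>2 * B i (Suc j)) + a * (L\<^sup>2 * B (Suc i) j)"
      proof (intro add_mono mult_left_mono)
        show "(dist ?z ((R ^^ i) x))\<^sup>2 \<le> L\<^sup>2 * B i (Suc j)" using IHi[of "Suc j"] by (metis dist_commute)
        have "dist ?z (F ?y) \<le> dist ((F ^^ j) x) ?y" using nonexpansiveD[OF F] by simp
        then have "(dist ?z (F ?y))\<^sup>2 \<le> (dist ?y ((F ^^ j) x))\<^sup>2"
          by (intro power_mono) (auto simp: dist_commute)
        then show "(dist ?z (F ?y))\<^sup>2 \<le> L\<^sup>2 * B (Suc i) j" using Suc by linarith
      qed (use a in auto)
      also have "\<dots> = L\<^sup>2 * ((1 - a) * B i (Suc j) + a * B (Suc i) j)" by (simp add: algebra_simps)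
      also have "\<dots> = L\<^sup>2 * B (Suc i) (Suc j)" by (simp only: rec)
      finally show ?case .
    qed
  qed
  then show ?thesis unfolding R_def a_def B_def .
qed

text \<open>Nonexpansiveness provides equicontinuity, so pointwise convergence of the maps passes to
  every fixed power.\<close>

lemma funpow_tendsto:
  fixes R :: "nat \<Rightarrow> 'b::metric_space \<Rightarrow> 'b"
  assumes R: "\<And>n. n \<ge> 1 \<Longrightarrow> nonexpansive (R n)" and lim: "\<And>x. (\<lambda>n. R n x) \<longlonglongrightarrow> J x"
  shows "(\<lambda>n. (R n ^^ m) x) \<longlonglongrightarrow> (J ^^ m) x"
proof (induction m)
  case (Suc m)
  have up: "(\<lambda>n. dist ((R n ^^ m) x) ((J ^^ m) x) + dist (R n ((J ^^ m) x)) (J ((J ^^ m) x))) \<longlonglongrightarrow> 0 + 0"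
    using Suc lim[of "(J ^^ m) x"] by (intro tendsto_add) (simp_all add: tendsto_dist_iff[symmetric])
  have "(\<lambda>n. dist ((R n ^^ Suc m) x) ((J ^^ Suc m) x)) \<longlonglongrightarrow> 0"
  proof (rule tendsto_sandwich[OF _ _ tendsto_const])
    show "\<forall>\<^sub>F n in sequentially. dist ((R n ^^ Suc m) x) ((J ^^ Suc m) x)
        \<le> dist ((R n ^^ m) x) ((J ^^ m) x) + dist (R n ((J ^^ m) x)) (J ((J ^^ m) x))"
    proof (rule eventually_sequentiallyI[of 1])
      fix n :: nat assume "1 \<le> n"
      then show "dist ((R n ^^ Suc m) x) ((J ^^ Suc m) x)
          \<le> dist ((R n ^^ m) x) ((J ^^ m) x) + dist (R n ((J ^^ m) x)) (J ((J ^^ m) x))"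
        using nonexpansiveD[OF R, of n "(R n ^^ m) x" "(J ^^ m) x"]
          dist_triangle[of "R n ((R n ^^ m) x)" "J ((J ^^ m) x)" "R n ((J ^^ m) x)"] by simp
    qed
  qed (use up in auto)
  then show ?case using tendsto_dist_iff by blast
qed simp

text \<open>A starting point \<open>x\<close> need not satisfy \<open>d(x, F\<^sub>n x) = O(t/n)\<close>; replacing it by
  \<open>ires (F n) _ x\<close> with a fixed parameter \<open>lam\<close> restores this bound at the cost of
  \<open>d(x, J lam x)\<close>.\<close>
lemma chernoff:
  fixes F :: "nat \<Rightarrow> 'a \<Rightarrow> 'a"
  assumes t: "t > 0" and F: "\<And>n. n \<ge> 1 \<Longrightarrow> nonexpansive (F n)"
    and conv: "\<And>lam x. lam > 0 \<Longrightarrow> (\<lambda>n. ires (F n) (lam / (lam + t / real n)) x) \<longlonglongrightarrow> J lam x"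
    and small: "\<And>e. e > 0 \<Longrightarrow> \<exists>lam>0. dist x (J lam x) < e"
    and e: "e > 0"
  shows "\<exists>M\<ge>1. \<forall>m\<ge>M. \<forall>\<^sub>F n in sequentially. dist ((F n ^^ n) x) ((J (t / real m) ^^ m) x) < e"
proof -
  obtain lam where lam: "lam > 0" "dist x (J lam x) < e / 8" using small[of "e / 8"] e by auto
  define X where "X n = ires (F n) (lam / (lam + t / real n)) x" for n
  \<comment> \<open>The speed bound of \<open>F n\<close> at \<open>X n\<close> as soon as
    \<open>dist x (X n) < e / 8\<close>.\<close>
  define L where "L = e / (8 * lam)"
  have "(\<lambda>n. dist x (X n)) \<longlonglongrightarrow> dist x (J lam x)" unfolding X_def by (intro tendsto_intros conv lam)
  then have near: "\<forall>\<^sub>F n in sequentially. dist x (X n) < e / 8" using lam(2) by (rule order_tendstoD)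
  \<comment> \<open>Since \<open>32 = 2 * 16\<close>, this makes Kobayashi's bound
    \<open>2 * L\<^sup>2 * t\<^sup>2 / m\<close> smaller than
    \<open>(e / 4)\<^sup>2\<close>.\<close>
  obtain M :: nat where M: "real M > 32 * L\<^sup>2 * t\<^sup>2 / e\<^sup>2" using reals_Archimedean2 by blast
  show ?thesis
  proof (intro exI[of _ "Suc M"] conjI allI impI)
    fix m assume m: "Suc M \<le> m"
    define \<mu> where "\<mu> = t / real m"
    have mpos: "real m > 0" "\<mu> > 0" using m t by (auto simp: \<mu>_def)
    have "32 * L\<^sup>2 * t\<^sup>2 / e\<^sup>2 < real m" using M m by linarith
    then have mL: "L\<^sup>2 * t\<^sup>2 * 2 / real m < (e / 4)\<^sup>2" using mpos e by (simp add: field_simps)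
    define R where "R n = ires (F n) (\<mu> / (\<mu> + t / real n))" for n
    have R: "nonexpansive (R n)" if "n \<ge> 1" for n
      unfolding R_def using that F mpos t by (intro nonexpansive_ires) (auto simp: add_pos_pos)
    have "(\<lambda>n. (R n ^^ m) x) \<longlonglongrightarrow> (J \<mu> ^^ m) x"
      unfolding R_def by (rule funpow_tendsto[OF _ conv[OF mpos(2)]]) (use R in \<open>simp add: R_def\<close>)
    then have "\<forall>\<^sub>F n in sequentially. dist ((R n ^^ m) x) ((J \<mu> ^^ m) x) < e / 4"
      using e by (intro tendstoD) auto
    with near eventually_ge_at_top[of m]
    show "\<forall>\<^sub>F n in sequentially. dist ((F n ^^ n) x) ((J (t / real m) ^^ m) x) < e"
    proof eventually_elim
      case (elim n)
      have n: "n \<ge> 1" using elim m by simp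
      define \<rho> where "\<rho> = t / real n"
      have rho: "\<rho> > 0" using n t by (simp add: \<rho>_def)
      have "lam * dist (X n) (F n (X n)) = \<rho> * dist x (X n)"
        unfolding X_def \<rho>_def[symmetric] using ires_dist(1)[OF F[OF n] lam(1) rho] .
      also have "\<dots> \<le> \<rho> * (e / 8)" using elim(1) rho by (intro mult_left_mono) auto
      finally have "dist (X n) (F n (X n)) \<le> L * \<rho>" using lam(1) by (simp add: L_def field_simps)
      from ires_funpow_dist[OF F[OF n] mpos(2) rho this, of m n]
      have "(dist ((R n ^^ m) (X n)) ((F n ^^ n) (X n)))\<^sup>2
          \<le> L\<^sup>2 * ((real m * \<mu> - real n * \<rho>)\<^sup>2 + real m * \<mu>\<^sup>2 + real n * \<rho>\<^sup>2)"
        by (simp add: R_def \<rho>_def)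
      also have "real m * \<mu> = t" using mpos by (simp add: \<mu>_def)
      also have "real n * \<rho> = t" using n by (simp add: \<rho>_def)
      \<comment> \<open>Both iterations run up to the same time \<open>t\<close>, so the leading
        square vanishes and only the terms of order \<open>1 / m\<close> and \<open>1 / n\<close>
        remain; \<open>n \<ge> m\<close> bounds them by \<open>2 / m\<close>.\<close>
      also have "(t - t)\<^sup>2 + real m * \<mu>\<^sup>2 + real n * \<rho>\<^sup>2 = t\<^sup>2 * (1 / real m + 1 / real n)"
        using mpos n by (simp add: \<mu>_def \<rho>_def power2_eq_square field_simps)
      also have "L\<^sup>2 * (t\<^sup>2 * (1 / real m + 1 / real n)) \<le> L\<^sup>2 * (t\<^sup>2 * (1 / real m + 1 / real m))"
        using elim(2) mpos n by (intro mult_left_mono add_left_mono) (auto simp: frac_le)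
      also have "\<dots> = L\<^sup>2 * t\<^sup>2 * 2 / real m" by simp
      also note mL
      finally have "dist ((R n ^^ m) (X n)) ((F n ^^ n) (X n)) < e / 4"
        by (rule power2_less_imp_less) (use e in simp)
      moreover have "dist ((R n ^^ m) x) ((R n ^^ m) (X n)) \<le> dist x (X n)"
        "dist ((F n ^^ n) x) ((F n ^^ n) (X n)) \<le> dist x (X n)"
        by (intro nonexpansiveD nonexpansive_funpow R F n)+
      moreover note dist_triangle[of "(F n ^^ n) x" "(J \<mu> ^^ m) x" "(F n ^^ n) (X n)"]
        dist_triangle3[of "(F n ^^ n) (X n)" "(J \<mu> ^^ m) x" "(R n ^^ m) (X n)"]
        dist_triangle3[of "(R n ^^ m) (X n)" "(J \<mu> ^^ m) x" "(R n ^^ m) x"]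
      ultimately show "dist ((F n ^^ n) x) ((J (t / real m) ^^ m) x) < e"
        using elim(1,3) e unfolding \<mu>_def[symmetric] by linarith
    qed
  qed auto
qed

end

section \<open>Splitting\<close>

lemma nonexpansive_comp_upto:
  assumes "\<And>j. j \<in> {1..k} \<Longrightarrow> nonexpansive (F j)"
  shows "nonexpansive (comp_upto k F)"
  using assms
proof (induction k)
  case (Suc k)
  then have "nonexpansive (F (Suc k))" "nonexpansive (comp_upto k F)" by auto
  then show ?case unfolding nonexpansive_def by simp (meson order_trans)
qed (simp add: nonexpansive_def)

locale splitting = hadamard T for T :: "'a::metric_space itself" +
  fixes k :: nat and Ds :: "nat \<Rightarrow> 'a set" and Gs :: "nat \<Rightarrow> 'a \<Rightarrow> real"
  assumes summands: "\<And>j. j \<in> {1..k} \<Longrightarrow> convex_lsc (Ds j) (Gs j)"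
    and common_point: "(\<Inter>j\<in>{1..k}. Ds j) \<noteq> {}"
begin

definition D :: "'a set" where "D = (\<Inter>j\<in>{1..k}. Ds j)"

definition G :: "'a \<Rightarrow> real" where "G x = (\<Sum>j\<in>{1..k}. Gs j x)"

lemma convex_lsc_total: "convex_lsc D G"
  using convex_lsc_sum[OF _ summands common_point] unfolding D_def G_def by blast

text \<open>The inequalities of the factors telescope. The gain \<open>E\<close> is left abstract:
  for resolvents it is the distance moved, for flows the distance to the projection. It is evaluated
  at the input of factor \<open>j\<close>, which is the output of factor
  \<open>j - 1\<close>.\<close>

lemma comp_upto_evi:
  assumes evi: "\<And>j u z. j \<in> {1..k} \<Longrightarrow> z \<in> Ds j \<Longrightarrow>
      (dist (F j u) z)\<^sup>2 + (E j u)\<^sup>2 \<le> (dist u z)\<^sup>2 + 2 * \<rho> * (Gs j z - Gs j (F j u))"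
    and z: "z \<in> D" and i: "i \<le> k"
  shows "(dist (comp_upto i F y) z)\<^sup>2 + (\<Sum>j\<in>{1..i}. (E j (comp_upto (j - 1) F y))\<^sup>2)
    \<le> (dist y z)\<^sup>2 + 2 * \<rho> * ((\<Sum>j\<in>{1..i}. Gs j z) - (\<Sum>j\<in>{1..i}. Gs j (comp_upto j F y)))"
  using i
proof (induction i)
  case (Suc i)
  let ?u = "comp_upto i F y"
  have "(dist (F (Suc i) ?u) z)\<^sup>2 + (E (Suc i) ?u)\<^sup>2 \<le> (dist ?u z)\<^sup>2 + 2 * \<rho> * (Gs (Suc i) z - Gs (Suc i) (F (Suc i) ?u))"
    using Suc.prems z by (intro evi) (auto simp: D_def)
  then show ?case using Suc.IH Suc.prems unfolding sum.cl_ivl_Suc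
    by (simp add: algebra_simps)
qed simp

text \<open>An analogue of the resolvent inequality for \<open>G\<close>, with the summands
  evaluated at the intermediate points and a penalty of weight \<open>lam / \<rho>\<close>. The
  CAT(0) inequality at \<open>y\<close> times \<open>lam + \<rho>\<close> and the telescoped
  inequality times \<open>lam\<close> are added; the terms \<open>lam * (dist y z)\<^sup>2\<close>
  cancel, and division by \<open>\<rho>\<close> remains.\<close>

lemma ires_comp_upto_evi:
  fixes x :: 'a
  assumes evi: "\<And>j u z. j \<in> {1..k} \<Longrightarrow> z \<in> Ds j \<Longrightarrow>
      (dist (F j u) z)\<^sup>2 + (E j u)\<^sup>2 \<le> (dist u z)\<^sup>2 + 2 * \<rho> * (Gs j z - Gs j (F j u))"
    and F: "\<And>j. j \<in> {1..k} \<Longrightarrow> nonexpansive (F j)"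
    and pos: "lam > 0" "\<rho> > 0" and z: "z \<in> D"
  defines "y \<equiv> ires (comp_upto k F) (lam / (lam + \<rho>)) x"
  shows "(dist y z)\<^sup>2 + (dist x y)\<^sup>2 + 2 * lam * (\<Sum>j\<in>{1..k}. Gs j (comp_upto j F y))
      + lam / \<rho> * (\<Sum>j\<in>{1..k}. (E j (comp_upto (j - 1) F y))\<^sup>2)
    \<le> (dist x z)\<^sup>2 + 2 * lam * G z"
proof -
  define a where "a = lam / (lam + \<rho>)"
  define w where "w = comp_upto k F y"
  define S where "S = (\<Sum>j\<in>{1..k}. Gs j (comp_upto j F y))"
  define Q where "Q = (\<Sum>j\<in>{1..k}. (E j (comp_upto (j - 1) F y))\<^sup>2)"
  have a: "0 \<le> a" "a < 1" using pos by (auto simp: a_def)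
  have y: "gp x w a = y"
    unfolding y_def a_def w_def using ires_eq[OF nonexpansive_comp_upto[OF F]] pos by simp
  have al: "(lam + \<rho>) * a = lam" "(lam + \<rho>) * (1 - a) = \<rho>" using pos by (auto simp: a_def field_simps)
  have 1: "(dist z y)\<^sup>2 \<le> (1 - a) * (dist z x)\<^sup>2 + a * (dist z w)\<^sup>2 - a * (1 - a) * (dist x w)\<^sup>2"
    using gp_cat0[of a z x w] a y by simp
  have "(lam + \<rho>) * (dist z y)\<^sup>2
      \<le> (lam + \<rho>) * ((1 - a) * (dist z x)\<^sup>2 + a * (dist z w)\<^sup>2 - a * (1 - a) * (dist x w)\<^sup>2)"
    using 1 pos by (intro mult_left_mono) auto
  also have "\<dots> = ((lam + \<rho>) * (1 - a)) * (dist z x)\<^sup>2 + ((lam + \<rho>) * a) * (dist z w)\<^sup>2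
      - ((lam + \<rho>) * (1 - a)) * (a * (dist x w)\<^sup>2)" by (simp add: algebra_simps)
  also have "\<dots> = \<rho> * (dist z x)\<^sup>2 + lam * (dist z w)\<^sup>2 - \<rho> * (a * (dist x w)\<^sup>2)"
    by (simp only: al)
  finally have 2: "(lam + \<rho>) * (dist z y)\<^sup>2 \<le> \<rho> * (dist z x)\<^sup>2 + lam * (dist z w)\<^sup>2 - \<rho> * (a * (dist x w)\<^sup>2)" .
  have "(dist w z)\<^sup>2 \<le> (dist y z)\<^sup>2 + 2 * \<rho> * (G z - S) - Q"
    using comp_upto_evi[where F = F and E = E and i = k and y = y and \<rho> = \<rho>, OF evi z]
    unfolding w_def S_def Q_def G_def by simp
  then have "lam * (dist w z)\<^sup>2 \<le> lam * ((dist y z)\<^sup>2 + 2 * \<rho> * (G z - S) - Q)"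
    using pos by (intro mult_left_mono) auto
  moreover have "lam * Q = \<rho> * (lam / \<rho> * Q)" using pos by simp
  ultimately have "\<rho> * ((dist y z)\<^sup>2 + a * (dist x w)\<^sup>2 + 2 * lam * S + lam / \<rho> * Q)
      \<le> \<rho> * ((dist x z)\<^sup>2 + 2 * lam * G z)"
    using 2 by (simp add: dist_commute algebra_simps)
  then have 3: "(dist y z)\<^sup>2 + a * (dist x w)\<^sup>2 + 2 * lam * S + lam / \<rho> * Q \<le> (dist x z)\<^sup>2 + 2 * lam * G z"
    using pos by simp
  have "dist x y = a * dist x w" using dist_gp_left[of a x w] a y by simp
  \<comment> \<open>The CAT(0) inequality yields \<open>a * (dist x w)\<^sup>2\<close>, which
    dominates \<open>(dist x y)\<^sup>2\<close> because \<open>a \<le> 1\<close>.\<close>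
  then have "(dist x y)\<^sup>2 = a * (a * (dist x w)\<^sup>2)" by (simp add: power2_eq_square)
  also have "\<dots> \<le> 1 * (a * (dist x w)\<^sup>2)" using a by (intro mult_right_mono) auto
  finally show ?thesis using 3 unfolding S_def Q_def by linarith
qed

text \<open>Half of the penalty and the term \<open>(dist x (Z 0))\<^sup>2\<close> suffice to absorb
  the linear lower bounds of the summands, with \<open>B\<close> uniform in the weight. The other
  half is kept: it later forces the gaps between neighbours to 0.\<close>

lemma penalty_coercive:
  fixes x :: 'a
  assumes lam: "lam > 0" and kap: "\<kappa>0 > 0"
  shows "\<exists>B. \<forall>\<kappa>\<ge>\<kappa>0. \<forall>Z. (\<forall>j\<in>{1..k}. Z j \<in> Ds j) \<longrightarrow>
     B + \<kappa> / 2 * (\<Sum>j\<in>{1..k}. (dist (Z (j - 1)) (Z j))\<^sup>2)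
       \<le> 2 * lam * (\<Sum>j\<in>{1..k}. Gs j (Z j)) + (dist x (Z 0))\<^sup>2 + \<kappa> * (\<Sum>j\<in>{1..k}. (dist (Z (j - 1)) (Z j))\<^sup>2)"
proof -
  have "\<forall>j\<in>{1..k}. \<exists>b c. c \<ge> 0 \<and> (\<forall>y\<in>Ds j. b - c * dist x y \<le> Gs j y)"
    using convex_lsc_lower_bound[OF summands] by blast
  then obtain b c where bc: "\<And>j. j \<in> {1..k} \<Longrightarrow> c j \<ge> 0"
      "\<And>j y. j \<in> {1..k} \<Longrightarrow> y \<in> Ds j \<Longrightarrow> b j - c j * dist x y \<le> Gs j y"
    by metis
  define C where "C = 2 * lam * (\<Sum>j\<in>{1..k}. c j)"
  \<comment> \<open>\<open>C\<close> is the slope of the combined linear lower bound. The term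
    \<open>C\<^sup>2 / 4\<close> is the cost of absorbing \<open>C * dist x (Z 0)\<close>, and each
    of the \<open>k\<close> terms \<open>C\<^sup>2 / (2 * \<kappa>0)\<close> that of absorbing one
    \<open>C * e j\<close>.\<close>
  define B where "B = 2 * lam * (\<Sum>j\<in>{1..k}. b j) - C\<^sup>2 / 4 - real k * (C\<^sup>2 / (2 * \<kappa>0))"
  show ?thesis
  proof (intro exI[of _ B] allI impI)
    fix \<kappa> :: real and Z :: "nat \<Rightarrow> 'a"
    assume \<kappa>: "\<kappa>0 \<le> \<kappa>" and Z: "\<forall>j\<in>{1..k}. Z j \<in> Ds j"
    define e where "e j = dist (Z (j - 1)) (Z j)" for j
    define d where "d = dist x (Z 0) + (\<Sum>j\<in>{1..k}. e j)"
    have path: "dist x (Z i) \<le> dist x (Z 0) + (\<Sum>j\<in>{1..i}. e j)" for i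
    proof (induction i)
      case (Suc i)
      then show ?case using dist_triangle[of x "Z (Suc i)" "Z i"] by (simp add: e_def)
    qed simp
    have dj: "dist x (Z j) \<le> d" if "j \<in> {1..k}" for j
    proof -
      have "(\<Sum>j\<in>{1..j}. e j) \<le> (\<Sum>j\<in>{1..k}. e j)"
        using that by (intro sum_mono2) (auto simp: e_def)
      then show ?thesis using path[of j] unfolding d_def by linarith
    qed
    have "(\<Sum>j\<in>{1..k}. b j) - (\<Sum>j\<in>{1..k}. c j) * d = (\<Sum>j\<in>{1..k}. b j - c j * d)"
      by (simp add: sum_subtractf sum_distrib_right)
    also have "\<dots> \<le> (\<Sum>j\<in>{1..k}. Gs j (Z j))"
    proof (rule sum_mono)
      fix j assume j: "j \<in> {1..k}"
      have "c j * dist x (Z j) \<le> c j * d" using bc(1)[OF j] dj[OF j] by (intro mult_left_mono)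
      then show "b j - c j * d \<le> Gs j (Z j)" using bc(2)[OF j, of "Z j"] Z j by force
    qed
    finally have "2 * lam * ((\<Sum>j\<in>{1..k}. b j) - (\<Sum>j\<in>{1..k}. c j) * d) \<le> 2 * lam * (\<Sum>j\<in>{1..k}. Gs j (Z j))"
      using lam by (intro mult_left_mono) auto
    then have 1: "2 * lam * (\<Sum>j\<in>{1..k}. b j) - C * d \<le> 2 * lam * (\<Sum>j\<in>{1..k}. Gs j (Z j))"
      by (simp add: C_def algebra_simps)
    have 2: "C * dist x (Z 0) \<le> (dist x (Z 0))\<^sup>2 + C\<^sup>2 / 4"
      using linear_le_quadratic[of "1/2" C "dist x (Z 0)"] by simp
    have "C * (\<Sum>j\<in>{1..k}. e j) = (\<Sum>j\<in>{1..k}. C * e j)" by (rule sum_distrib_left)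
    also have "\<dots> \<le> (\<Sum>j\<in>{1..k}. \<kappa> / 2 * (e j)\<^sup>2 + C\<^sup>2 / (2 * \<kappa>0))"
    proof (rule sum_mono)
      fix j
      have "C * e j \<le> (e j)\<^sup>2 / (2 * (1 / \<kappa>)) + C\<^sup>2 * (1 / \<kappa>) / 2"
        using kap \<kappa> by (intro linear_le_quadratic) auto
      moreover have "C\<^sup>2 * (1 / \<kappa>) / 2 \<le> C\<^sup>2 / (2 * \<kappa>0)" using kap \<kappa> by (simp add: frac_le)
      ultimately show "C * e j \<le> \<kappa> / 2 * (e j)\<^sup>2 + C\<^sup>2 / (2 * \<kappa>0)" by (simp add: mult.commute)
    qed
    also have "\<dots> = \<kappa> / 2 * (\<Sum>j\<in>{1..k}. (e j)\<^sup>2) + real k * (C\<^sup>2 / (2 * \<kappa>0))"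
      by (simp add: sum.distrib sum_distrib_left)
    finally have 3: "C * (\<Sum>j\<in>{1..k}. e j) \<le> \<kappa> / 2 * (\<Sum>j\<in>{1..k}. (e j)\<^sup>2) + real k * (C\<^sup>2 / (2 * \<kappa>0))" .
    have "C * d = C * dist x (Z 0) + C * (\<Sum>j\<in>{1..k}. e j)" by (simp add: d_def distrib_left)
    then show "B + \<kappa> / 2 * (\<Sum>j\<in>{1..k}. (dist (Z (j - 1)) (Z j))\<^sup>2)
       \<le> 2 * lam * (\<Sum>j\<in>{1..k}. Gs j (Z j)) + (dist x (Z 0))\<^sup>2 + \<kappa> * (\<Sum>j\<in>{1..k}. (dist (Z (j - 1)) (Z j))\<^sup>2)"
      unfolding B_def e_def[symmetric] using 1 2 3 by argo
  qed
qed

end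

definition flow :: "'a::metric_space set \<Rightarrow> ('a \<Rightarrow> real) \<Rightarrow> real \<Rightarrow> 'a \<Rightarrow> 'a" where
  "flow D G t x = lim (\<lambda>n. (prox D G (t / real n) ^^ n) x)"

section \<open>Convergence of the implicit steps for resolvents\<close>

context splitting
begin

lemma total_lsc_limit:
  assumes "\<And>j. j \<in> {1..k} \<Longrightarrow> u j \<longlonglongrightarrow> q"
    and "\<And>j. j \<in> {1..k} \<Longrightarrow> \<forall>\<^sub>F n in sequentially. u j n \<in> Ds j"
    and "\<forall>\<^sub>F n in sequentially. (\<Sum>j\<in>{1..k}. Gs j (u j n)) \<le> a n" "a \<longlonglongrightarrow> l"
  shows "q \<in> D" "G q \<le> l"
  using sum_lsc_limit[OF _ summands assms] unfolding D_def G_def by auto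

text \<open>As the weight grows the penalized infima increase to the minimal value of the
  unpenalized problem: almost minimizers converge at index 0, the gaps vanish, and so the whole
  tuple collapses to one point \<open>q\<close> of \<open>D\<close>. The entry \<open>Z 0\<close>
  belongs to no domain; it stands for the implicit step.\<close>

lemma penalized_min_tendsto:
  fixes x :: 'a
  assumes lam: "lam > 0" and t: "t > 0"
  defines "p \<equiv> prox D G lam x"
  defines "\<Phi> \<equiv> \<lambda>n Z. 2 * lam * (\<Sum>j\<in>{1..k}. Gs j (Z j)) + (dist x (Z 0))\<^sup>2
      + lam * real (Suc n) / t * (\<Sum>j\<in>{1..k}. (dist (Z (j - 1)) (Z j))\<^sup>2)"
  shows "\<exists>W. W \<longlonglongrightarrow> (dist x p)\<^sup>2 + 2 * lam * G p \<and>
    (\<forall>n Z. (\<forall>j\<in>{1..k}. Z j \<in> Ds j) \<longrightarrow> W n \<le> \<Phi> n Z)"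
proof -
  define m where "m = (dist x p)\<^sup>2 + 2 * lam * G p"
  define Q where "Q = {Z :: nat \<Rightarrow> 'a. \<forall>j\<in>{1..k}. Z j \<in> Ds j}"
  \<comment> \<open>This is \<open>lam / \<rho>\<close> for
    \<open>\<rho> = t / real (Suc n)\<close>, the weight in
    \<open>ires_comp_upto_evi\<close>.\<close>
  define \<kappa> where "\<kappa> n = lam * real (Suc n) / t" for n
  define e where "e Z j = dist (Z (j - 1)) (Z j)" for Z :: "nat \<Rightarrow> 'a" and j
  have \<Phi>: "\<Phi> n Z = 2 * lam * (\<Sum>j\<in>{1..k}. Gs j (Z j)) + (dist x (Z 0))\<^sup>2 + \<kappa> n * (\<Sum>j\<in>{1..k}. (e Z j)\<^sup>2)"
    for n Z unfolding \<Phi>_def \<kappa>_def e_def ..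
  have \<kappa>mono: "\<kappa> n \<le> \<kappa> n'" if "n \<le> n'" for n n'
    using lam t that by (auto simp: \<kappa>_def divide_right_mono)
  have \<kappa>pos: "\<kappa> n > 0" for n using lam t by (simp add: \<kappa>_def)
  have pD: "p \<in> D" unfolding p_def by (rule prox_mem[OF convex_lsc_total lam])
  have z0: "(\<lambda>_. p) \<in> Q" "\<Phi> n (\<lambda>_. p) \<le> m" for n
    using pD by (auto simp: Q_def D_def \<Phi> m_def e_def G_def)
  obtain B where B: "\<And>n Z. Z \<in> Q \<Longrightarrow> B + \<kappa> n / 2 * (\<Sum>j\<in>{1..k}. (e Z j)\<^sup>2) \<le> \<Phi> n Z"
    using penalty_coercive[OF lam \<kappa>pos[of 0], of x] \<kappa>mono[of 0] unfolding \<Phi> e_def Q_def by blast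
  have lower: "B \<le> \<Phi> n Z" if "Z \<in> Q" for n Z
  proof -
    have "0 \<le> \<kappa> n / 2 * (\<Sum>j\<in>{1..k}. (e Z j)\<^sup>2)"
      using \<kappa>pos[of n] by (intro mult_nonneg_nonneg sum_nonneg) auto
    then show ?thesis using B[OF that, of n] by linarith
  qed
  have mono: "\<Phi> n Z \<le> \<Phi> n' Z" if "n \<le> n'" "Z \<in> Q" for n n' Z
    unfolding \<Phi> using \<kappa>mono[OF that(1)] by (intro add_left_mono mult_right_mono sum_nonneg) auto
  \<comment> \<open>The competitor is the componentwise midpoint. Summands and penalty are merely
    convex; uniform convexity comes from \<open>(dist x (Z 0))\<^sup>2\<close>, so it controls entry
    0 only.\<close>
  have mid: "\<exists>w\<in>Q. \<forall>n. \<Phi> n w + 1/4 * (dist (u 0) (v 0))\<^sup>2 \<le> (\<Phi> n u + \<Phi> n v) / 2"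
    if uv: "u \<in> Q" "v \<in> Q" for u v
  proof (intro bexI allI)
    let ?w = "\<lambda>j. gp (u j) (v j) (1/2)"
    show "?w \<in> Q" using uv convex_lscD(2)[OF summands] unfolding Q_def by auto
    fix n
    have "(\<Sum>j\<in>{1..k}. Gs j (?w j)) \<le> (\<Sum>j\<in>{1..k}. (Gs j (u j) + Gs j (v j)) / 2)"
    proof (rule sum_mono)
      fix j assume j: "j \<in> {1..k}"
      show "Gs j (?w j) \<le> (Gs j (u j) + Gs j (v j)) / 2"
        using convex_lscD(3)[OF summands[OF j], of "u j" "v j" "1/2"] uv j unfolding Q_def by simp
    qed
    then have "2 * lam * (\<Sum>j\<in>{1..k}. Gs j (?w j)) \<le> 2 * lam * (\<Sum>j\<in>{1..k}. (Gs j (u j) + Gs j (v j)) / 2)"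
      using lam by (intro mult_left_mono) auto
    then have 1: "2 * lam * (\<Sum>j\<in>{1..k}. Gs j (?w j))
        \<le> (2 * lam * (\<Sum>j\<in>{1..k}. Gs j (u j)) + 2 * lam * (\<Sum>j\<in>{1..k}. Gs j (v j))) / 2"
      by (simp add: sum.distrib sum_divide_distrib[symmetric] distrib_left)
    have 2: "(dist x (?w 0))\<^sup>2 \<le> (dist x (u 0))\<^sup>2 / 2 + (dist x (v 0))\<^sup>2 / 2 - (dist (u 0) (v 0))\<^sup>2 / 4"
      using gp_cat0[of "1/2" x "u 0" "v 0"] by simp
    have "(\<Sum>j\<in>{1..k}. (e ?w j)\<^sup>2) \<le> (\<Sum>j\<in>{1..k}. ((e u j)\<^sup>2 + (e v j)\<^sup>2) / 2)"
      unfolding e_def by (intro sum_mono dist_midpoints_sq)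
    then have "\<kappa> n * (\<Sum>j\<in>{1..k}. (e ?w j)\<^sup>2) \<le> \<kappa> n * (\<Sum>j\<in>{1..k}. ((e u j)\<^sup>2 + (e v j)\<^sup>2) / 2)"
      using \<kappa>pos[of n] by (intro mult_left_mono) auto
    then have 3: "\<kappa> n * (\<Sum>j\<in>{1..k}. (e ?w j)\<^sup>2)
        \<le> (\<kappa> n * (\<Sum>j\<in>{1..k}. (e u j)\<^sup>2) + \<kappa> n * (\<Sum>j\<in>{1..k}. (e v j)\<^sup>2)) / 2"
      by (simp add: sum.distrib sum_divide_distrib[symmetric] distrib_left)
    show "\<Phi> n ?w + 1/4 * (dist (u 0) (v 0))\<^sup>2 \<le> (\<Phi> n u + \<Phi> n v) / 2"
      unfolding \<Phi> using 1 2 3 by argo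
  qed
  have "\<exists>V W Z. V \<le> m \<and> W \<longlonglongrightarrow> V \<and> (\<forall>n. \<forall>z\<in>Q. W n \<le> \<Phi> n z)
    \<and> (\<forall>n. Z n \<in> Q) \<and> (\<lambda>n. \<Phi> n (Z n)) \<longlonglongrightarrow> V \<and> Cauchy (\<lambda>n. (Z n) 0)"
    by (intro almost_minimizers_Cauchy[where \<pi> = "\<lambda>Z. Z 0" and \<Phi> = \<Phi> and B = B and c = "1/4" and Q = Q, OF z0])
      (use lower mono mid in auto)
  then obtain V W Z where V: "V \<le> m" "W \<longlonglongrightarrow> V" "\<And>n z. z \<in> Q \<Longrightarrow> W n \<le> \<Phi> n z"
    and Z: "\<And>n. Z n \<in> Q" "(\<lambda>n. \<Phi> n (Z n)) \<longlonglongrightarrow> V" "Cauchy (\<lambda>n. Z n 0)" by blast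
  obtain q where q: "(\<lambda>n. Z n 0) \<longlonglongrightarrow> q" using Z(3) by (rule Cauchy_imp_limit)
  \<comment> \<open>The spare half of the penalty is bounded by the convergent
    \<open>\<Phi> n (Z n) - B\<close>, while its weight tends to infinity.\<close>
  have gap: "(\<lambda>n. dist (Z n (j - 1)) (Z n j)) \<longlonglongrightarrow> 0" if j: "j \<in> {1..k}" for j
  proof -
    have up: "(e (Z n) j)\<^sup>2 \<le> (2 * t / lam) * ((\<Phi> n (Z n) - B) * (1 / real (Suc n)))" for n
    proof -
      have "(e (Z n) j)\<^sup>2 \<le> (\<Sum>j\<in>{1..k}. (e (Z n) j)\<^sup>2)" using j by (intro member_le_sum) auto
      then have "\<kappa> n / 2 * (e (Z n) j)\<^sup>2 \<le> \<kappa> n / 2 * (\<Sum>j\<in>{1..k}. (e (Z n) j)\<^sup>2)"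
        using \<kappa>pos[of n] by (intro mult_left_mono) auto
      then have "\<kappa> n / 2 * (e (Z n) j)\<^sup>2 \<le> \<Phi> n (Z n) - B" using B[OF Z(1), of n n] by linarith
      then have "(e (Z n) j)\<^sup>2 \<le> (\<Phi> n (Z n) - B) / (\<kappa> n / 2)"
        using \<kappa>pos[of n] by (subst pos_le_divide_eq) (auto simp: mult.commute)
      also have "\<dots> = (2 * t / lam) * ((\<Phi> n (Z n) - B) * (1 / real (Suc n)))"
        unfolding \<kappa>_def by simp
      finally show ?thesis .
    qed
    have "(\<lambda>n. 1 / real (Suc n)) \<longlonglongrightarrow> 0"
      using LIMSEQ_inverse_real_of_nat by (simp add: inverse_eq_divide)
    then have "(\<lambda>n. (2 * t / lam) * ((\<Phi> n (Z n) - B) * (1 / real (Suc n)))) \<longlonglongrightarrow> (2 * t / lam) * ((V - B) * 0)"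
      by (intro tendsto_intros Z)
    then have lim0: "(\<lambda>n. (2 * t / lam) * ((\<Phi> n (Z n) - B) * (1 / real (Suc n)))) \<longlonglongrightarrow> 0" by simp
    have "(\<lambda>n. (e (Z n) j)\<^sup>2) \<longlonglongrightarrow> 0"
      by (rule tendsto_sandwich[OF _ _ tendsto_const lim0]) (use up in auto)
    then have "(\<lambda>n. sqrt ((e (Z n) j)\<^sup>2)) \<longlonglongrightarrow> sqrt 0" by (intro tendsto_real_sqrt)
    then show ?thesis by (simp add: e_def)
  qed
  have Zq: "(\<lambda>n. Z n i) \<longlonglongrightarrow> q" if "i \<le> k" for i
    using that
  proof (induction i)
    case (Suc i)
    have "(\<lambda>n. dist (Z n i) (Z n (Suc i)) + dist (Z n i) q) \<longlonglongrightarrow> 0 + 0"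
      using gap[of "Suc i"] Suc by (intro tendsto_add) (auto simp: tendsto_dist_iff[symmetric])
    then have lim0: "(\<lambda>n. dist (Z n i) (Z n (Suc i)) + dist (Z n i) q) \<longlonglongrightarrow> 0" by simp
    have "(\<lambda>n. dist (Z n (Suc i)) q) \<longlonglongrightarrow> 0"
      by (rule tendsto_sandwich[OF _ _ tendsto_const lim0]) (auto simp: dist_triangle3)
    then show ?case using tendsto_dist_iff by blast
  qed (rule q)
  have ev: "(\<Sum>j\<in>{1..k}. Gs j (Z n j)) \<le> (\<Phi> n (Z n) - (dist x (Z n 0))\<^sup>2) / (2 * lam)" for n
  proof -
    have "0 \<le> \<kappa> n * (\<Sum>j\<in>{1..k}. (e (Z n) j)\<^sup>2)"
      using \<kappa>pos[of n] by (intro mult_nonneg_nonneg sum_nonneg) auto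
    then have "2 * lam * (\<Sum>j\<in>{1..k}. Gs j (Z n j)) \<le> \<Phi> n (Z n) - (dist x (Z n 0))\<^sup>2"
      unfolding \<Phi> by linarith
    then show ?thesis using lam by (simp add: field_simps)
  qed
  have lim: "(\<lambda>n. (\<Phi> n (Z n) - (dist x (Z n 0))\<^sup>2) / (2 * lam)) \<longlonglongrightarrow> (V - (dist x q)\<^sup>2) / (2 * lam)"
    using lam by (intro tendsto_intros Z q) auto
  have "\<forall>\<^sub>F n in sequentially. Z n j \<in> Ds j" if "j \<in> {1..k}" for j
    using Z(1) that unfolding Q_def by auto
  from total_lsc_limit[of "\<lambda>j n. Z n j" q, OF _ this always_eventually[rule_format, OF ev] lim] Zq
  have qD: "q \<in> D" and "G q \<le> (V - (dist x q)\<^sup>2) / (2 * lam)" by auto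
  then have "2 * lam * G q + (dist x q)\<^sup>2 \<le> V" using lam by (simp add: field_simps)
  moreover have "(dist p q)\<^sup>2 + (dist x p)\<^sup>2 \<le> (dist x q)\<^sup>2 + 2 * lam * (G q - G p)"
    unfolding p_def by (rule prox_evi[OF convex_lsc_total lam qD])
  then have "m \<le> (dist x q)\<^sup>2 + 2 * lam * G q"
    using zero_le_power2[of "dist p q"] unfolding m_def right_diff_distrib by linarith
  ultimately have "V = m" using V(1) by linarith
  then show ?thesis using V(2,3) unfolding m_def Q_def by blast
qed

text \<open>The intermediate points of the implicit step form an admissible tuple. Their penalized
  value is at least \<open>W n\<close>, whereas the variational inequality bounds its sum with
  \<open>(dist (y n) p)\<^sup>2\<close> by the minimal value \<open>m\<close>; hence
  \<open>(dist (y n) p)\<^sup>2 \<le> m - W n\<close>.\<close>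

lemma ires_prox_tendsto:
  fixes x :: 'a
  assumes lam: "lam > 0" and t: "t > 0"
  shows "(\<lambda>n. ires (comp_upto k (\<lambda>j. prox (Ds j) (Gs j) (t / real n))) (lam / (lam + t / real n)) x)
    \<longlonglongrightarrow> prox D G lam x"
proof -
  define p where "p = prox D G lam x"
  define P where "P n j = prox (Ds j) (Gs j) (t / real (Suc n))" for n j
  define y where "y n = ires (comp_upto k (P n)) (lam / (lam + t / real (Suc n))) x" for n
  define m where "m = (dist x p)\<^sup>2 + 2 * lam * G p"
  obtain W where W: "W \<longlonglongrightarrow> m" and W_le: "\<And>n Z. \<forall>j\<in>{1..k}. Z j \<in> Ds j \<Longrightarrow>
      W n \<le> 2 * lam * (\<Sum>j\<in>{1..k}. Gs j (Z j)) + (dist x (Z 0))\<^sup>2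
        + lam * real (Suc n) / t * (\<Sum>j\<in>{1..k}. (dist (Z (j - 1)) (Z j))\<^sup>2)"
    using penalized_min_tendsto[OF lam t, of x] unfolding m_def p_def by blast
  have pD: "p \<in> D" unfolding p_def by (rule prox_mem[OF convex_lsc_total lam])
  have *: "(dist (y n) p)\<^sup>2 \<le> m - W n" for n
  proof -
    define \<rho> where "\<rho> = t / real (Suc n)"
    have rho: "\<rho> > 0" using t by (simp add: \<rho>_def)
    define Z where "Z j = comp_upto j (P n) (y n)" for j
    have PD: "P n j u \<in> Ds j" if "j \<in> {1..k}" for j u
      unfolding P_def \<rho>_def[symmetric] by (rule prox_mem[OF summands[OF that] rho])
    have ZD: "Z j \<in> Ds j" if "j \<in> {1..k}" for j
      using PD[OF that] that unfolding Z_def by (cases j) auto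
    have Zd: "dist (Z (j - 1)) (P n j (Z (j - 1))) = dist (Z (j - 1)) (Z j)" if "j \<in> {1..k}" for j
      using that by (cases j) (auto simp: Z_def)
    have "(dist (y n) p)\<^sup>2 + (dist x (y n))\<^sup>2 + 2 * lam * (\<Sum>j\<in>{1..k}. Gs j (comp_upto j (P n) (y n)))
      + lam / \<rho> * (\<Sum>j\<in>{1..k}. (dist (comp_upto (j - 1) (P n) (y n)) (P n j (comp_upto (j - 1) (P n) (y n))))\<^sup>2)
      \<le> (dist x p)\<^sup>2 + 2 * lam * G p"
      unfolding y_def \<rho>_def[symmetric]
    proof (rule ires_comp_upto_evi[where E = "\<lambda>j u. dist u (P n j u)", OF _ _ lam rho pD])
      fix j u z assume j: "j \<in> {1..k}" and z: "z \<in> Ds j"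
      show "(dist (P n j u) z)\<^sup>2 + (dist u (P n j u))\<^sup>2 \<le> (dist u z)\<^sup>2 + 2 * \<rho> * (Gs j z - Gs j (P n j u))"
        unfolding P_def \<rho>_def[symmetric] by (rule prox_evi[OF summands[OF j] rho z])
    next
      fix j assume j: "j \<in> {1..k}"
      show "nonexpansive (P n j)"
        unfolding P_def \<rho>_def[symmetric] by (rule nonexpansive_prox[OF summands[OF j] rho])
    qed
    then have "(dist (y n) p)\<^sup>2 + (dist x (Z 0))\<^sup>2 + 2 * lam * (\<Sum>j\<in>{1..k}. Gs j (Z j))
        + lam / \<rho> * (\<Sum>j\<in>{1..k}. (dist (Z (j - 1)) (P n j (Z (j - 1))))\<^sup>2) \<le> m"
      unfolding m_def Z_def by simp
    also have "(\<Sum>j\<in>{1..k}. (dist (Z (j - 1)) (P n j (Z (j - 1))))\<^sup>2) = (\<Sum>j\<in>{1..k}. (dist (Z (j - 1)) (Z j))\<^sup>2)"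
      by (intro sum.cong refl) (simp only: Zd)
    finally show ?thesis using W_le[of Z n] ZD unfolding \<rho>_def by simp
  qed
  have lim: "(\<lambda>n. m - W n) \<longlonglongrightarrow> 0" using tendsto_diff[OF tendsto_const W, of m] by simp
  have "(\<lambda>n. (dist (y n) p)\<^sup>2) \<longlonglongrightarrow> 0"
    by (rule tendsto_sandwich[OF _ _ tendsto_const lim]) (use * in auto)
  then have "y \<longlonglongrightarrow> p" by (rule dist_sq_tendsto_zeroD)
  then show ?thesis unfolding y_def P_def p_def
    by (rule filterlim_sequentially_Suc[THEN iffD1])
qed

lemma prox_near:
  fixes x :: 'a
  assumes x: "x \<in> closure D" and e: "e > 0"
  shows "\<exists>lam>0. dist x (prox D G lam x) < e"
proof -
  have "(\<lambda>n. 1 / real n) \<longlonglongrightarrow> 0" by (rule lim_1_over_n)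
  then have "(\<lambda>n. prox D G (1 / real n) x) \<longlonglongrightarrow> x"
    by (intro prox_tendsto[OF convex_lsc_total x]) auto
  then have "\<forall>\<^sub>F n in sequentially. dist (prox D G (1 / real n) x) x < e" using e by (intro tendstoD)
  then have "\<forall>\<^sub>F n in sequentially. n \<ge> 1 \<and> dist (prox D G (1 / real n) x) x < e"
    using eventually_ge_at_top[of 1] by eventually_elim auto
  then obtain n where "n \<ge> (1::nat)" "dist (prox D G (1 / real n) x) x < e"
    unfolding eventually_sequentially by blast
  then show ?thesis by (intro exI[of _ "1 / real n"]) (auto simp: dist_commute)
qed

text \<open>The comparison is with finite resolvent iterates instead of the flow, because the case
  of a single summand is what proves that the flow exists.\<close>

lemma comp_prox_near:
  fixes x :: 'a
  assumes t: "t > 0" and x: "x \<in> closure D" and e: "e > 0"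
  shows "\<exists>M\<ge>1. \<forall>m\<ge>M. \<forall>\<^sub>F n in sequentially.
    dist ((comp_upto k (\<lambda>j. prox (Ds j) (Gs j) (t / real n)) ^^ n) x) ((prox D G (t / real m) ^^ m) x) < e"
  using t by (intro chernoff[where F = "\<lambda>n. comp_upto k (\<lambda>j. prox (Ds j) (Gs j) (t / real n))", OF t _ ires_prox_tendsto prox_near[OF x] e]
    nonexpansive_comp_upto nonexpansive_prox summands) auto

end

section \<open>Existence of the gradient flow\<close>

context hadamard
begin

text \<open>For one summand the composition is the resolvent itself, so
  \<open>comp_prox_near\<close> places almost all iterates near one fixed point, which makes them
  Cauchy.\<close>

lemma flow_tendsto:
  fixes D :: "'a set"
  assumes c: "convex_lsc D G" and t: "t > 0" and x: "x \<in> closure D"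
  shows "(\<lambda>n. (prox D G (t / real n) ^^ n) x) \<longlonglongrightarrow> flow D G t x"
proof -
  interpret S: splitting T 1 "\<lambda>_. D" "\<lambda>_. G"
    by unfold_locales (use c convex_lscD(1)[OF c] in auto)
  have DG: "S.D = D" "S.G = G" unfolding S.D_def S.G_def by auto
  have "Cauchy (\<lambda>n. (prox D G (t / real n) ^^ n) x)"
  proof (rule metric_CauchyI)
    fix e :: real assume e: "e > 0"
    from S.comp_prox_near[OF t _ half_gt_zero[OF e], of x] x obtain m where
      "\<forall>\<^sub>F n in sequentially. dist ((prox D G (t / real n) ^^ n) x) ((prox D G (t / real m) ^^ m) x) < e / 2"
      unfolding DG by auto
    then obtain N where N: "\<And>n. n \<ge> N \<Longrightarrow> dist ((prox D G (t / real n) ^^ n) x) ((prox D G (t / real m) ^^ m) x) < e / 2"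
      unfolding eventually_sequentially by blast
    show "\<exists>M. \<forall>m\<ge>M. \<forall>n\<ge>M. dist ((prox D G (t / real m) ^^ m) x) ((prox D G (t / real n) ^^ n) x) < e"
      using N dist_triangle_half_l by blast
  qed
  then obtain l where "(\<lambda>n. (prox D G (t / real n) ^^ n) x) \<longlonglongrightarrow> l" by (rule Cauchy_imp_limit)
  then show ?thesis unfolding flow_def using convergent_LIMSEQ_iff convergent_def by blast
qed

lemma tendsto_flowI:
  fixes D :: "'a set"
  assumes c: "convex_lsc D G" and t: "t > 0" and x: "x \<in> closure D"
    and near: "\<And>e. e > 0 \<Longrightarrow> \<exists>M\<ge>1. \<forall>m\<ge>M. \<forall>\<^sub>F n in sequentially. dist (u n) ((prox D G (t / real m) ^^ m) x) < e"
  shows "u \<longlonglongrightarrow> flow D G t x"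
proof (rule tendstoI)
  fix e :: real assume e: "e > 0"
  obtain M where M: "\<And>m. m \<ge> M \<Longrightarrow> \<forall>\<^sub>F n in sequentially. dist (u n) ((prox D G (t / real m) ^^ m) x) < e / 2"
    using near[OF half_gt_zero[OF e]] by blast
  have "\<forall>\<^sub>F m in sequentially. dist ((prox D G (t / real m) ^^ m) x) (flow D G t x) < e / 2"
    using flow_tendsto[OF c t x] half_gt_zero[OF e] by (rule tendstoD)
  then obtain N where N: "\<And>m. m \<ge> N \<Longrightarrow> dist ((prox D G (t / real m) ^^ m) x) (flow D G t x) < e / 2"
    unfolding eventually_sequentially by blast
  from M[OF max.cobounded1] show "\<forall>\<^sub>F n in sequentially. dist (u n) (flow D G t x) < e"
  proof (rule eventually_mono)
    fix n assume "dist (u n) ((prox D G (t / real (max M N)) ^^ (max M N)) x) < e / 2"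
    then show "dist (u n) (flow D G t x) < e"
      using N[of "max M N"] dist_triangle_half_r[of "(prox D G (t / real (max M N)) ^^ (max M N)) x" "u n" e "flow D G t x"]
      by (simp add: dist_commute)
  qed
qed

end

context splitting
begin

theorem comp_prox_tendsto_flow:
  fixes x :: 'a
  assumes "t > 0" "x \<in> closure D"
  shows "(\<lambda>n. (comp_upto k (\<lambda>j. prox (Ds j) (Gs j) (t / real n)) ^^ n) x) \<longlonglongrightarrow> flow D G t x"
  by (intro tendsto_flowI[OF convex_lsc_total assms] comp_prox_near[OF assms])

end

section \<open>Gradient flows, projections and compactness\<close>

context hadamard
begin

text \<open>The one-step inequalities are summed. Values of \<open>G\<close> decrease along the
  iteration, so each of them may be replaced by the last.\<close>

lemma prox_funpow_evi:
  fixes D :: "'a set"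
  assumes c: "convex_lsc D G" and lam: "lam > 0" and z: "z \<in> D"
  shows "(dist ((prox D G lam ^^ i) u) z)\<^sup>2 \<le> (dist u z)\<^sup>2 + 2 * lam * real i * (G z - G ((prox D G lam ^^ i) u))"
proof (induction i)
  case (Suc i)
  let ?v = "(prox D G lam ^^ i) u" and ?w = "(prox D G lam ^^ Suc i) u"
  have "(dist ?w z)\<^sup>2 + (dist ?v ?w)\<^sup>2 \<le> (dist ?v z)\<^sup>2 + 2 * lam * (G z - G ?w)"
    using prox_evi[OF c lam z, of ?v] by simp
  then have 1: "(dist ?w z)\<^sup>2 \<le> (dist ?v z)\<^sup>2 + 2 * lam * (G z - G ?w)"
    using zero_le_power2[of "dist ?v ?w"] by linarith
  \<comment> \<open>For \<open>i = 0\<close> the point \<open>u\<close> may lie outside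
    \<open>D\<close>, where \<open>G\<close> says nothing; the factor \<open>real i\<close> removes
    that term.\<close>
  have 2: "2 * lam * real i * (G z - G ?v) \<le> 2 * lam * real i * (G z - G ?w)"
  proof (cases "i = 0")
    case False
    then have v: "?v \<in> D" using prox_mem[OF c lam] by (cases i) auto
    have "(dist ?w ?v)\<^sup>2 + (dist ?v ?w)\<^sup>2 \<le> 2 * lam * (G ?v - G ?w)"
      using prox_evi[OF c lam v, of ?v] by simp
    then have "0 \<le> 2 * lam * (G ?v - G ?w)"
      using zero_le_power2[of "dist ?w ?v"] zero_le_power2[of "dist ?v ?w"] by linarith
    then have "G ?w \<le> G ?v" using lam by (simp add: zero_le_mult_iff)
    then show ?thesis using lam by (intro mult_left_mono) auto
  qed simp
  show ?case using Suc 1 2 by (simp add: algebra_simps)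
qed simp

text \<open>Here \<open>n\<close> steps of length \<open>t / n\<close> are taken. The iterated
  inequality is solved for \<open>G (v n)\<close>, and lower semicontinuity passes it to the limit;
  the bound on \<open>G\<close> also places the flow in \<open>D\<close> itself, even when
  \<open>u\<close> is only in the closure.\<close>

lemma flow_mem_evi:
  fixes D :: "'a set"
  assumes c: "convex_lsc D G" and t: "t > 0" and u: "u \<in> closure D"
  shows flow_mem: "flow D G t u \<in> D"
    and flow_evi: "\<And>z. z \<in> D \<Longrightarrow> (dist (flow D G t u) z)\<^sup>2 \<le> (dist u z)\<^sup>2 + 2 * t * (G z - G (flow D G t u))"
proof -
  define v where "v n = (prox D G (t / real n) ^^ n) u" for n
  have v: "v \<longlonglongrightarrow> flow D G t u" unfolding v_def by (rule flow_tendsto[OF assms])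
  have *: "flow D G t u \<in> D" "G (flow D G t u) \<le> G z + ((dist u z)\<^sup>2 - (dist (flow D G t u) z)\<^sup>2) / (2 * t)"
    if z: "z \<in> D" for z
  proof -
    have ev: "\<forall>\<^sub>F n in sequentially. v n \<in> D \<and> G (v n) \<le> G z + ((dist u z)\<^sup>2 - (dist (v n) z)\<^sup>2) / (2 * t)"
    proof (rule eventually_sequentiallyI[of 1])
      fix n :: nat assume n: "1 \<le> n"
      have lam: "t / real n > 0" using t n by simp
      have "v n \<in> D" unfolding v_def using prox_mem[OF c lam] n by (cases n) auto
      moreover have "(dist (v n) z)\<^sup>2 \<le> (dist u z)\<^sup>2 + 2 * t * (G z - G (v n))"
        using prox_funpow_evi[OF c lam z, of n u] n unfolding v_def by simp
      then have "G (v n) \<le> G z + ((dist u z)\<^sup>2 - (dist (v n) z)\<^sup>2) / (2 * t)"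
        using t by (simp add: field_simps)
      ultimately show "v n \<in> D \<and> G (v n) \<le> G z + ((dist u z)\<^sup>2 - (dist (v n) z)\<^sup>2) / (2 * t)" by blast
    qed
    have lim: "(\<lambda>n. G z + ((dist u z)\<^sup>2 - (dist (v n) z)\<^sup>2) / (2 * t))
        \<longlonglongrightarrow> G z + ((dist u z)\<^sup>2 - (dist (flow D G t u) z)\<^sup>2) / (2 * t)"
      using t by (intro tendsto_intros v) auto
    show "flow D G t u \<in> D" "G (flow D G t u) \<le> G z + ((dist u z)\<^sup>2 - (dist (flow D G t u) z)\<^sup>2) / (2 * t)"
      using convex_lsc_limit[OF c v ev lim] by auto
  qed
  show "flow D G t u \<in> D" using *(1) convex_lscD(1)[OF c] by blast
  show "(dist (flow D G t u) z)\<^sup>2 \<le> (dist u z)\<^sup>2 + 2 * t * (G z - G (flow D G t u))" if "z \<in> D" for z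
    using *(2)[OF that] t by (simp add: field_simps)
qed

lemma flow_nonexpansive:
  fixes D :: "'a set"
  assumes c: "convex_lsc D G" and t: "t > 0" and u: "u \<in> closure D" "v \<in> closure D"
  shows "dist (flow D G t u) (flow D G t v) \<le> dist u v"
proof -
  have "(\<lambda>n. dist ((prox D G (t / real n) ^^ n) u) ((prox D G (t / real n) ^^ n) v))
      \<longlonglongrightarrow> dist (flow D G t u) (flow D G t v)"
    by (intro tendsto_dist flow_tendsto c t u)
  moreover have "dist ((prox D G (t / real n) ^^ n) u) ((prox D G (t / real n) ^^ n) v) \<le> dist u v"
    if "n \<ge> 1" for n
    using that t by (intro nonexpansiveD nonexpansive_funpow nonexpansive_prox c) auto
  ultimately show ?thesis by (intro LIMSEQ_le_const2) auto
qed

text \<open>The pair \<open>closure D\<close>, \<open>\<lambda>_. 0\<close> encodes the indicator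
  function of the closed domain, so facts about resolvents apply to the metric projection.\<close>

lemma convex_lsc_closure:
  fixes D :: "'a set"
  assumes c: "convex_lsc D G"
  shows "convex_lsc (closure D) (\<lambda>_. 0)"
  unfolding convex_lsc_def
proof (intro conjI ballI allI impI; (elim conjE)?)
  show "closure D \<noteq> {}" using convex_lscD(1)[OF c] by simp
  fix x y and t :: real
  assume xy: "x \<in> closure D" "y \<in> closure D" and t: "t \<in> {0..1}"
  show "gp x y t \<in> closure D"
    unfolding closure_approachable
  proof (intro allI impI)
    fix e :: real assume e: "e > 0"
    obtain x' y' where x': "x' \<in> D" "dist x' x < e" and y': "y' \<in> D" "dist y' y < e"
      using xy e unfolding closure_approachable by blast
    have "dist (gp x' y' t) (gp x y t) \<le> (1 - t) * dist x' x + t * dist y' y"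
      using t by (intro dist_gp_gp) auto
    also have "\<dots> < e" using convex_bound_lt[OF x'(2) y'(2), of "1 - t" t] t by simp
    finally show "\<exists>z\<in>D. dist z (gp x y t) < e"
      using convex_lscD(2)[OF c x'(1) y'(1)] t by auto
  qed
next
  fix u x and a :: real
  assume u: "\<forall>n. u n \<in> closure D \<and> 0 \<le> a" "u \<longlonglongrightarrow> x"
  show "x \<in> closure D" using closed_sequentially[OF closed_closure] u by blast
  show "0 \<le> a" using u by blast
qed auto

text \<open>The Hopf-Rinow argument: the supremum of the radii of compact balls cannot be finite.\<close>
lemma convex_closed_ball_compact:
  fixes A :: "'a set"
  assumes cl: "closed A" and conv: "\<And>x y t. x \<in> A \<Longrightarrow> y \<in> A \<Longrightarrow> 0 \<le> t \<Longrightarrow> t \<le> 1 \<Longrightarrow> gp x y t \<in> A"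
    and loc: "\<And>z. z \<in> A \<Longrightarrow> \<exists>d>0. compact (A \<inter> cball z d)"
    and w: "w \<in> A"
  shows "compact (A \<inter> cball w r)"
proof (rule ccontr)
  assume nc: "\<not> compact (A \<inter> cball w r)"
  define S where "S = {s. compact (A \<inter> cball w s)}"
  have down: "s' \<in> S" if "s \<in> S" "s' \<le> s" for s s'
  proof -
    have "A \<inter> cball w s' = (A \<inter> cball w s) \<inter> cball w s'" using that(2) by auto
    then show ?thesis using that(1) unfolding S_def by (metis closed_cball compact_Int_closed mem_Collect_eq)
  qed
  have bdd: "s \<le> r" if "s \<in> S" for s using down[OF that, of r] nc unfolding S_def by force
  obtain d0 where d0: "d0 > 0" "d0 \<in> S" using loc[OF w] unfolding S_def by blast
  define R where "R = Sup S"
  have bddS: "bdd_above S" using bdd by (intro bdd_aboveI)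
  have R0: "R > 0" using cSup_upper[OF d0(2) bddS] d0(1) unfolding R_def by linarith
  have below: "s \<in> S" if "s < R" for s
    using that less_cSup_iff[of S s] d0(2) bddS down unfolding R_def by fastforce
  \<comment> \<open>The supremum is attained: pulling points of the ball towards \<open>w\<close> to
    radius \<open>s < R\<close> moves them by at most \<open>e / 2\<close>, so a finite net for
    radius \<open>s\<close> serves for \<open>R\<close>.\<close>
  have comp: "compact (A \<inter> cball w R)"
    unfolding compact_eq_totally_bounded
  proof (intro conjI allI impI)
    show "complete (A \<inter> cball w R)"
      using complete_UNIV_hadamard cl by (metis closed_Int closed_cball complete_closed_subset subset_UNIV)
    fix e :: real assume e: "e > 0"
    define s where "s = max 0 (R - e / 2)"
    have s: "0 \<le> s" "s < R" "R - s \<le> e / 2" using R0 e unfolding s_def by (auto simp: max_def)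
    obtain K where K: "finite K" "A \<inter> cball w s \<subseteq> (\<Union>x\<in>K. ball x (e / 2))"
      using below[OF s(2)] half_gt_zero[OF e] unfolding S_def compact_eq_totally_bounded by blast
    have "A \<inter> cball w R \<subseteq> (\<Union>x\<in>K. ball x e)"
    proof
      fix z assume z: "z \<in> A \<inter> cball w R"
      define z' where "z' = gp w z (s / R)"
      have q: "0 \<le> s / R" "s / R \<le> 1" using s R0 by auto
      have zR: "dist w z \<le> R" using z by simp
      have "dist w z' = s / R * dist w z" unfolding z'_def by (rule dist_gp_left[OF q])
      also have "\<dots> \<le> s / R * R" using zR q by (intro mult_left_mono) auto
      finally have "dist w z' \<le> s" using R0 by simp
      then have "z' \<in> A \<inter> cball w s" using conv[OF w, of z "s / R"] z q by (auto simp: z'_def)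
      then obtain x where x: "x \<in> K" "dist x z' < e / 2" using K(2) by auto
      have "dist z z' = (1 - s / R) * dist w z" unfolding z'_def by (rule dist_gp_right[OF q])
      also have "\<dots> \<le> (1 - s / R) * R" using zR q by (intro mult_left_mono) auto
      also have "\<dots> = R - s" using R0 by (simp add: field_simps)
      finally have "dist z z' \<le> e / 2" using s(3) by simp
      then have "dist x z < e" using x(2) dist_triangle2[of x z z'] by linarith
      then show "z \<in> (\<Union>x\<in>K. ball x e)" using x(1) by auto
    qed
    then show "\<exists>k. finite k \<and> A \<inter> cball w R \<subseteq> (\<Union>x\<in>k. ball x e)" using K(1) by blast
  qed
  \<comment> \<open>Finitely many compact balls cover the ball of radius \<open>R\<close>. A
    Lebesgue number \<open>e\<close> of this cover shows that they contain the ball of radius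
    \<open>R + e / 2\<close> as well, against the choice of \<open>R\<close>.\<close>
  obtain d where d: "\<And>z. z \<in> A \<Longrightarrow> d z > 0" "\<And>z. z \<in> A \<Longrightarrow> compact (A \<inter> cball z (d z))"
    using loc by metis
  obtain K where K: "K \<subseteq> A \<inter> cball w R" "finite K" "A \<inter> cball w R \<subseteq> (\<Union>z\<in>K. ball z (d z))"
    using compactE_image[OF comp, of "A \<inter> cball w R" "\<lambda>z. ball z (d z)"] d(1) by force
  obtain e where e: "e > 0" "\<And>x. x \<in> A \<inter> cball w R \<Longrightarrow> \<exists>B\<in>(\<lambda>z. ball z (d z)) ` K. ball x e \<subseteq> B"
    using Heine_Borel_lemma[OF comp, of "(\<lambda>z. ball z (d z)) ` K"] K(3) by auto
  have sub: "A \<inter> cball w (R + e / 2) \<subseteq> (\<Union>z\<in>K. A \<inter> cball z (d z))"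
  proof
    fix z assume z: "z \<in> A \<inter> cball w (R + e / 2)"
    have "\<exists>z'\<in>A \<inter> cball w R. dist z' z < e"
    proof (cases "dist w z \<le> R")
      case True
      then show ?thesis using z e(1) by (intro bexI[of _ z]) auto
    next
      case False
      define q where "q = R / dist w z"
      have q: "0 \<le> q" "q \<le> 1" "q * dist w z = R" using False R0 by (auto simp: q_def divide_le_eq_1)
      have "dist w (gp w z q) = R" using dist_gp_left[OF q(1,2)] q(3) by simp
      moreover have "dist z (gp w z q) = dist w z - R"
        using dist_gp_right[OF q(1,2), of z w] q(3) by (simp add: algebra_simps)
      ultimately show ?thesis using conv[OF w, of z q] z q e(1)
        by (intro bexI[of _ "gp w z q"]) (auto simp: dist_commute)
    qed
    then obtain z' where z': "z' \<in> A \<inter> cball w R" "z \<in> ball z' e" by auto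
    then obtain v where "v \<in> K" "z \<in> ball v (d v)" using e(2)[OF z'(1)] by blast
    then show "z \<in> (\<Union>z\<in>K. A \<inter> cball z (d z))" using z by force
  qed
  have "compact (\<Union>z\<in>K. A \<inter> cball z (d z))" using K d(2) by (intro compact_UN) auto
  moreover have "closed (A \<inter> cball w (R + e / 2))" using cl by auto
  ultimately have "compact (A \<inter> cball w (R + e / 2))"
    using sub by (metis compact_Int_closed inf.absorb_iff2)
  then have "R + e / 2 \<le> R" using cSup_upper[OF _ bddS] unfolding S_def R_def by blast
  then show False using e(1) by simp
qed

text \<open>The domain itself need not be proper, even though it is convex and locally compact; its sublevel
  sets are, because they are complete.\<close>
lemma sublevel_ball_compact:
  fixes D :: "'a set"
  assumes c: "convex_lsc D G" and lc: "locally compact D" and w: "w \<in> D" "G w \<le> a"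
  shows "compact ({z \<in> D. G z \<le> a} \<inter> cball w r)"
proof (rule convex_closed_ball_compact)
  let ?A = "{z \<in> D. G z \<le> a}"
  show cl: "closed ?A"
    unfolding closed_sequential_limits using c unfolding convex_lsc_def by blast
  show "gp x y t \<in> ?A" if "x \<in> ?A" "y \<in> ?A" "0 \<le> t" "t \<le> 1" for x y t
  proof -
    have "G (gp x y t) \<le> (1 - t) * G x + t * G y" using convex_lscD(3)[OF c] that by auto
    also have "\<dots> \<le> a" using that by (intro convex_bound_le) auto
    finally show ?thesis using convex_lscD(2)[OF c] that by auto
  qed
  show "\<exists>d>0. compact (?A \<inter> cball z d)" if z: "z \<in> ?A" for z
  proof -
    obtain U V where U: "openin (top_of_set D) U" "compact V" "z \<in> U" "U \<subseteq> V" "V \<subseteq> D"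
      using lc z unfolding locally_def by (metis (no_types, lifting) mem_Collect_eq openin_subtopology_self)
    obtain e where e: "e > 0" "ball z e \<inter> D \<subseteq> U"
      using U(1,3) unfolding openin_contains_ball by blast
    \<comment> \<open>Within a small ball around \<open>z\<close> the closed sublevel set lies in a
      compact neighbourhood of \<open>z\<close> in \<open>D\<close>.\<close>
    have "?A \<inter> cball z (e / 2) = V \<inter> (?A \<inter> cball z (e / 2))"
    proof -
      have "cball z (e / 2) \<inter> D \<subseteq> V" using e U(4) by (auto simp: subset_iff)
      then show ?thesis by auto
    qed
    moreover have "compact (V \<inter> (?A \<inter> cball z (e / 2)))"
      using U(2) cl by (intro compact_Int_closed closed_Int) auto
    ultimately show ?thesis using e(1) by (intro exI[of _ "e / 2"]) auto
  qed
  show "w \<in> ?A" using w by simp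
qed

end

definition nearest :: "'a::metric_space set \<Rightarrow> 'a \<Rightarrow> 'a" where
  "nearest C = prox C (\<lambda>_. 0) 1"

text \<open>The factor of the second product formula. Projecting first makes the flow a map on the
  whole space, as implicit steps require.\<close>

definition pflow :: "'a::metric_space set \<Rightarrow> ('a \<Rightarrow> real) \<Rightarrow> real \<Rightarrow> 'a \<Rightarrow> 'a" where
  "pflow D G t = flow D G t \<circ> nearest (closure D)"

section \<open>Projections and projected flows\<close>

context hadamard
begin

lemma nearest_mem:
  fixes C :: "'a set"
  shows "convex_lsc C (\<lambda>_. 0) \<Longrightarrow> nearest C x \<in> C"
  unfolding nearest_def by (rule prox_mem) auto

lemma nonexpansive_nearest:
  fixes C :: "'a set"
  shows "convex_lsc C (\<lambda>_. 0) \<Longrightarrow> nonexpansive (nearest C)"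
  unfolding nearest_def by (rule nonexpansive_prox) auto

lemma nearest_evi:
  fixes C :: "'a set"
  assumes "convex_lsc C (\<lambda>_. 0)" "z \<in> C"
  shows "(dist (nearest C x) z)\<^sup>2 + (dist x (nearest C x))\<^sup>2 \<le> (dist x z)\<^sup>2"
  using prox_evi[OF assms(1) zero_less_one assms(2), of x] unfolding nearest_def by simp

lemma nearest_id:
  fixes C :: "'a set"
  assumes "convex_lsc C (\<lambda>_. 0)" "x \<in> C"
  shows "nearest C x = x"
proof -
  have "(dist (nearest C x) x)\<^sup>2 + (dist x (nearest C x))\<^sup>2 \<le> 0"
    using nearest_evi[OF assms, of x] by simp
  then have "(dist (nearest C x) x)\<^sup>2 \<le> 0" using zero_le_power2[of "dist x (nearest C x)"] by linarith
  then show ?thesis by simp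
qed

context
  fixes D :: "'a set" and G :: "'a \<Rightarrow> real"
  assumes c: "convex_lsc D G"
begin

lemma pflow_mem: "t > 0 \<Longrightarrow> pflow D G t u \<in> D"
  unfolding pflow_def using flow_mem[OF c _ nearest_mem[OF convex_lsc_closure[OF c]]] by simp

text \<open>The flow inequality is started at the projection and contributes no gain of its own; the
  gain is the squared distance to the projection, from \<open>nearest_evi\<close>.\<close>

lemma pflow_evi:
  assumes t: "t > 0" and z: "z \<in> D"
  shows "(dist (pflow D G t u) z)\<^sup>2 + (dist u (nearest (closure D) u))\<^sup>2
    \<le> (dist u z)\<^sup>2 + 2 * t * (G z - G (pflow D G t u))"
proof -
  let ?p = "nearest (closure D) u"
  note cl = convex_lsc_closure[OF c]
  have "(dist (pflow D G t u) z)\<^sup>2 \<le> (dist ?p z)\<^sup>2 + 2 * t * (G z - G (pflow D G t u))"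
    using flow_evi[OF c t nearest_mem[OF cl] z] unfolding pflow_def by simp
  moreover have "(dist ?p z)\<^sup>2 + (dist u ?p)\<^sup>2 \<le> (dist u z)\<^sup>2"
    using nearest_evi[OF cl] z closure_subset by blast
  ultimately show ?thesis by linarith
qed

lemma nonexpansive_pflow:
  assumes t: "t > 0"
  shows "nonexpansive (pflow D G t)"
  unfolding nonexpansive_def pflow_def o_apply
proof (intro allI)
  fix x y :: 'a
  note cl = convex_lsc_closure[OF c]
  show "dist (flow D G t (nearest (closure D) x)) (flow D G t (nearest (closure D) y)) \<le> dist x y"
    using flow_nonexpansive[OF c t nearest_mem[OF cl] nearest_mem[OF cl], of x y]
      nonexpansiveD[OF nonexpansive_nearest[OF cl], of x y] by linarith
qed

lemma pflow_tendsto: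
  assumes rho: "rho \<longlonglongrightarrow> 0" "\<And>n. rho n > 0"
  shows "(\<lambda>n. pflow D G (rho n) w) \<longlonglongrightarrow> nearest (closure D) w"
proof -
  have zc: "z \<in> closure D" if "z \<in> D" for z using that closure_subset by blast
  show ?thesis unfolding pflow_def o_apply
  proof (rule nonexpansive_evi_tendsto[OF c nearest_mem[OF convex_lsc_closure[OF c]] rho])
    fix n z assume z: "z \<in> D"
    show "(dist (flow D G (rho n) z) z)\<^sup>2 \<le> 2 * rho n * (G z - G (flow D G (rho n) z))"
      using flow_evi[OF c rho(2) zc[OF z] z, of n] by simp
  qed (use flow_nonexpansive[OF c rho(2)] flow_mem[OF c rho(2) zc] in auto)
qed

end

lemma nonexpansive_tendsto:
  fixes F :: "nat \<Rightarrow> 'a \<Rightarrow> 'a"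
  assumes F: "\<And>n. nonexpansive (F n)" and u: "u \<longlonglongrightarrow> q" and q: "(\<lambda>n. F n q) \<longlonglongrightarrow> q'"
  shows "(\<lambda>n. F n (u n)) \<longlonglongrightarrow> q'"
proof -
  have "(\<lambda>n. dist (u n) q + dist (F n q) q') \<longlonglongrightarrow> 0 + 0"
    using u q by (intro tendsto_add) (simp_all add: tendsto_dist_iff[symmetric])
  then have lim0: "(\<lambda>n. dist (u n) q + dist (F n q) q') \<longlonglongrightarrow> 0" by simp
  have "dist (F n (u n)) q' \<le> dist (u n) q + dist (F n q) q'" for n
    using nonexpansiveD[OF F, of n "u n" q] dist_triangle[of "F n (u n)" q' "F n q"] by linarith
  then have "(\<lambda>n. dist (F n (u n)) q') \<longlonglongrightarrow> 0"
    by (intro tendsto_sandwich[OF _ _ tendsto_const lim0]) auto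
  then show ?thesis using tendsto_dist_iff by blast
qed

end

section \<open>Convergence of the implicit steps for projected flows\<close>

context splitting
begin

context
  fixes x :: 'a and lam :: real and rho :: "nat \<Rightarrow> real" and l :: nat
  assumes lam: "lam > 0" and rho: "rho \<longlonglongrightarrow> 0" "\<And>n. rho n > 0"
    and l: "l \<in> {1..k}" and lc: "locally compact (Ds l)"
begin

private definition F where "F n j = pflow (Ds j) (Gs j) (rho n)"
private definition y where "y n = ires (comp_upto k (F n)) (lam / (lam + rho n)) x"
private definition Y where "Y n j = comp_upto j (F n) (y n)"
private definition p where "p = prox D G lam x"
text \<open>This is \<open>2 * lam\<close> times the minimal value of the resolvent problem,
  attained at \<open>p\<close>.\<close>

private definition m where "m = (dist x p)\<^sup>2 + 2 * lam * G p"
private definition E where "E j u = dist u (nearest (closure (Ds j)) u)"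

private lemma pD: "p \<in> D" unfolding p_def by (rule prox_mem[OF convex_lsc_total lam])

private lemma F_nonexpansive: "j \<in> {1..k} \<Longrightarrow> nonexpansive (F n j)"
  unfolding F_def by (intro nonexpansive_pflow summands rho)

private lemma Y_Suc: "Y n (Suc j) = F n (Suc j) (Y n j)" and Y_0: "Y n 0 = y n"
  by (simp_all add: Y_def)

private lemma Y_mem: "j \<in> {1..k} \<Longrightarrow> Y n j \<in> Ds j"
  using pflow_mem[OF summands rho(2)] by (cases j) (auto simp: Y_Suc F_def)

private lemma Y_ineq:
  "(dist (y n) p)\<^sup>2 + (dist x (y n))\<^sup>2 + 2 * lam * (\<Sum>j\<in>{1..k}. Gs j (Y n j))
      + lam / rho n * (\<Sum>j\<in>{1..k}. (E j (Y n (j - 1)))\<^sup>2) \<le> m"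
  unfolding y_def Y_def m_def
proof (rule ires_comp_upto_evi[OF _ F_nonexpansive lam rho(2) pD])
  fix j u z assume j: "j \<in> {1..k}" and z: "z \<in> Ds j"
  show "(dist (F n j u) z)\<^sup>2 + (E j u)\<^sup>2 \<le> (dist u z)\<^sup>2 + 2 * rho n * (Gs j z - Gs j (F n j u))"
    unfolding F_def E_def by (rule pflow_evi[OF summands[OF j] rho(2) z])
qed

private lemma F_tendsto: "j \<in> {1..k} \<Longrightarrow> (\<lambda>n. F n j w) \<longlonglongrightarrow> nearest (closure (Ds j)) w"
  unfolding F_def by (intro pflow_tendsto summands rho)

text \<open>Every factor is nonexpansive and moves \<open>p\<close> by an amount that tends to 0,
  since \<open>p\<close> is fixed by all projections.\<close>

private lemma Y_dist:
  "\<forall>\<^sub>F n in sequentially. \<forall>i\<le>k. dist (Y n i) p \<le> dist (y n) p + 1"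
proof -
  have Fp: "(\<lambda>n. F n j p) \<longlonglongrightarrow> p" if j: "j \<in> {1..k}" for j
  proof -
    have "p \<in> closure (Ds j)" using pD j closure_subset unfolding D_def by blast
    from nearest_id[OF convex_lsc_closure[OF summands[OF j]] this] show ?thesis
      using F_tendsto[OF j, of p] by simp
  qed
  have "(\<lambda>n. \<Sum>j\<in>{1..k}. dist (F n j p) p) \<longlonglongrightarrow> (\<Sum>j\<in>{1..k}. dist p p)"
    by (intro tendsto_sum tendsto_dist Fp tendsto_const)
  then have "(\<lambda>n. \<Sum>j\<in>{1..k}. dist (F n j p) p) \<longlonglongrightarrow> 0" by simp
  then have "\<forall>\<^sub>F n in sequentially. (\<Sum>j\<in>{1..k}. dist (F n j p) p) < 1" by (rule order_tendstoD) simp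
  then show ?thesis
  proof eventually_elim
    case (elim n)
    have *: "dist (Y n i) p \<le> dist (y n) p + (\<Sum>j\<in>{1..i}. dist (F n j p) p)" if "i \<le> k" for i
      using that
    proof (induction i)
      case (Suc i)
      have "dist (Y n (Suc i)) p \<le> dist (F n (Suc i) (Y n i)) (F n (Suc i) p) + dist (F n (Suc i) p) p"
        unfolding Y_Suc by (rule dist_triangle)
      also have "\<dots> \<le> dist (Y n i) p + dist (F n (Suc i) p) p"
        using Suc.prems by (intro add_right_mono nonexpansiveD F_nonexpansive) auto
      finally show ?case using Suc by simp
    qed (simp add: Y_0)
    show ?case
    proof (intro allI impI)
      fix i assume i: "i \<le> k"
      have "(\<Sum>j\<in>{1..i}. dist (F n j p) p) \<le> (\<Sum>j\<in>{1..k}. dist (F n j p) p)"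
        using i by (intro sum_mono2) auto
      then show "dist (Y n i) p \<le> dist (y n) p + 1" using *[OF i] elim by linarith
    qed
  qed
qed

text \<open>The term \<open>(dist (y n) p)\<^sup>2\<close> in \<open>Y_ineq\<close> absorbs the
  linear lower bounds of the summands, because by \<open>Y_dist\<close> all intermediate points are
  as close to \<open>p\<close> as \<open>y n\<close>, up to 1.\<close>

private lemma Y_bounded:
  "\<exists>M b. \<forall>\<^sub>F n in sequentially. (\<forall>i\<le>k. dist (Y n i) p \<le> M) \<and> (\<forall>j\<in>{1..k}. b j \<le> Gs j (Y n j))"
proof -
  have "\<forall>j\<in>{1..k}. \<exists>b c. c \<ge> 0 \<and> (\<forall>y\<in>Ds j. b - c * dist p y \<le> Gs j y)"
    using convex_lsc_lower_bound[OF summands] by blast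
  then obtain b c where bc: "\<And>j. j \<in> {1..k} \<Longrightarrow> c j \<ge> 0"
      "\<And>j y. j \<in> {1..k} \<Longrightarrow> y \<in> Ds j \<Longrightarrow> b j - c j * dist p y \<le> Gs j y"
    by metis
  define C where "C = 2 * lam * (\<Sum>j\<in>{1..k}. c j)"
  define N where "N = sqrt (2 * (m - 2 * lam * (\<Sum>j\<in>{1..k}. b j) + C + C\<^sup>2 / 2)) + 1"
  have low: "b j - c j * R \<le> Gs j (Y n j)" if "j \<in> {1..k}" "dist (Y n j) p \<le> R" for n j R
  proof -
    have "c j * dist p (Y n j) \<le> c j * R" using bc(1)[OF that(1)] that(2)
      by (intro mult_left_mono) (auto simp: dist_commute)
    then show ?thesis using bc(2)[OF that(1) Y_mem[OF that(1)], of n] by linarith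
  qed
  have "\<forall>\<^sub>F n in sequentially. (\<forall>i\<le>k. dist (Y n i) p \<le> N) \<and> (\<forall>j\<in>{1..k}. b j - c j * N \<le> Gs j (Y n j))"
    using Y_dist
  proof eventually_elim
    case (elim n)
    let ?d = "dist (y n) p"
    have "(\<Sum>j\<in>{1..k}. b j) - (\<Sum>j\<in>{1..k}. c j) * (?d + 1) = (\<Sum>j\<in>{1..k}. b j - c j * (?d + 1))"
      by (simp add: sum_subtractf sum_distrib_right)
    also have "\<dots> \<le> (\<Sum>j\<in>{1..k}. Gs j (Y n j))" using elim low by (intro sum_mono) auto
    finally have "2 * lam * ((\<Sum>j\<in>{1..k}. b j) - (\<Sum>j\<in>{1..k}. c j) * (?d + 1)) \<le> 2 * lam * (\<Sum>j\<in>{1..k}. Gs j (Y n j))"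
      using lam by (intro mult_left_mono) auto
    then have 1: "2 * lam * (\<Sum>j\<in>{1..k}. b j) - C * ?d - C \<le> 2 * lam * (\<Sum>j\<in>{1..k}. Gs j (Y n j))"
      by (simp add: C_def algebra_simps)
    have "0 \<le> lam / rho n * (\<Sum>j\<in>{1..k}. (E j (Y n (j - 1)))\<^sup>2)"
      using lam rho(2)[of n] by (intro mult_nonneg_nonneg sum_nonneg) auto
    then have "?d\<^sup>2 + 2 * lam * (\<Sum>j\<in>{1..k}. Gs j (Y n j)) \<le> m"
      using Y_ineq[of n] zero_le_power2[of "dist x (y n)"] by linarith
    moreover have "C * ?d \<le> ?d\<^sup>2 / 2 + C\<^sup>2 / 2" using linear_le_quadratic[of 1 C ?d] by simp
    ultimately have "?d\<^sup>2 \<le> 2 * (m - 2 * lam * (\<Sum>j\<in>{1..k}. b j) + C + C\<^sup>2 / 2)" using 1 by argo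
    then have "?d \<le> N - 1" unfolding N_def using real_le_rsqrt by simp
    then have "\<forall>i\<le>k. dist (Y n i) p \<le> N" using elim by force
    then show ?case using low by auto
  qed
  then show ?thesis by (intro exI)
qed

text \<open>Compactness gives a limit of \<open>Y n l\<close> along a subsequence. The later factors
  carry it to \<open>Y n k\<close>, whose distance to \<open>y n\<close> vanishes, so
  \<open>y n\<close> has a limit \<open>q\<close>. Running through all factors from
  \<open>y n\<close>, with \<open>q\<close> fixed by every projection, sends all intermediate points
  to \<open>q\<close>; lower semicontinuity and the inequality for \<open>p\<close> then give
  \<open>q = p\<close>.\<close>

private lemma Y_subseq:
  "\<exists>s. strict_mono s \<and> (\<lambda>n. y (s n)) \<longlonglongrightarrow> p"
proof -
  obtain M b where ev: "\<forall>\<^sub>F n in sequentially. (\<forall>i\<le>k. dist (Y n i) p \<le> M) \<and> (\<forall>j\<in>{1..k}. b j \<le> Gs j (Y n j))"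
    using Y_bounded by blast
  then obtain N where N: "\<And>n i. n \<ge> N \<Longrightarrow> i \<le> k \<Longrightarrow> dist (Y n i) p \<le> M"
      "\<And>n j. n \<ge> N \<Longrightarrow> j \<in> {1..k} \<Longrightarrow> b j \<le> Gs j (Y n j)"
    unfolding eventually_sequentially by metis
  have Epos: "0 \<le> lam / rho n * (\<Sum>j\<in>{1..k}. (E j (Y n (j - 1)))\<^sup>2)" for n
    using lam rho(2)[of n] by (intro mult_nonneg_nonneg sum_nonneg) auto
  have Gl: "Gs l (Y n l) \<le> m / (2 * lam) - (\<Sum>j\<in>{1..k} - {l}. b j)" if n: "n \<ge> N" for n
  proof -
    have "2 * lam * (\<Sum>j\<in>{1..k}. Gs j (Y n j)) \<le> m"
      using Y_ineq[of n] Epos[of n] zero_le_power2[of "dist x (y n)"] zero_le_power2[of "dist (y n) p"] by linarith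
    then have "(\<Sum>j\<in>{1..k}. Gs j (Y n j)) \<le> m / (2 * lam)" using lam by (simp add: field_simps)
    moreover have "(\<Sum>j\<in>{1..k} - {l}. b j) \<le> (\<Sum>j\<in>{1..k} - {l}. Gs j (Y n j))"
      using N(2)[OF n] by (intro sum_mono) auto
    ultimately show ?thesis using sum.remove[OF _ l, of "\<lambda>j. Gs j (Y n j)"] by simp
  qed
  \<comment> \<open>The maximum with \<open>Gs l p\<close> puts \<open>p\<close>, the centre of the
    ball, into the sublevel set.\<close>
  define a where "a = max (m / (2 * lam) - (\<Sum>j\<in>{1..k} - {l}. b j)) (Gs l p)"
  have "p \<in> Ds l" using pD l unfolding D_def by blast
  then have comp: "compact ({z \<in> Ds l. Gs l z \<le> a} \<inter> cball p M)"
    by (intro sublevel_ball_compact[OF summands[OF l] lc]) (auto simp: a_def)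
  have "Y (n + N) l \<in> {z \<in> Ds l. Gs l z \<le> a} \<inter> cball p M" for n
    using Y_mem[OF l] Gl[of "n + N"] N(1)[of "n + N" l] l by (auto simp: a_def dist_commute)
  then obtain ql s' where ql: "strict_mono s'" "(\<lambda>n. Y (s' n + N) l) \<longlonglongrightarrow> ql"
    using comp[unfolded compact_def, rule_format, of "\<lambda>n. Y (n + N) l"] by (auto simp: o_def)
  define s where "s n = s' n + N" for n
  have s: "strict_mono s" using ql(1) by (simp add: s_def strict_mono_def)
  have sN: "s n \<ge> N" for n by (simp add: s_def)
  have shift: "(\<lambda>n. Y (s n) (Suc i)) \<longlonglongrightarrow> nearest (closure (Ds (Suc i))) q"
    if "Suc i \<le> k" "(\<lambda>n. Y (s n) i) \<longlonglongrightarrow> q" for i q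
    unfolding Y_Suc
  proof (rule nonexpansive_tendsto[OF _ that(2)])
    show "nonexpansive (F (s n) (Suc i))" for n using that by (intro F_nonexpansive) auto
    show "(\<lambda>n. F (s n) (Suc i) q) \<longlonglongrightarrow> nearest (closure (Ds (Suc i))) q"
      using LIMSEQ_subseq_LIMSEQ[OF F_tendsto s, of "Suc i" q] that(1) by (simp add: o_def)
  qed
  have "\<exists>q. (\<lambda>n. Y (s n) i) \<longlonglongrightarrow> q" if "l \<le> i" "i \<le> k" for i
    using that
  proof (induction i rule: dec_induct)
    case base
    then show ?case using ql(2) by (auto simp: s_def)
  next
    case (step i)
    then obtain q where "(\<lambda>n. Y (s n) i) \<longlonglongrightarrow> q" by auto
    from shift[OF step.prems this] show ?case by blast
  qed
  then obtain q where qk: "(\<lambda>n. Y (s n) k) \<longlonglongrightarrow> q" using l by auto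
  have rs: "(\<lambda>n. rho (s n)) \<longlonglongrightarrow> 0" using LIMSEQ_subseq_LIMSEQ[OF rho(1) s] by (simp add: o_def)
  \<comment> \<open>On the geodesic from \<open>x\<close> to \<open>Y n k\<close> the point
    \<open>y n\<close> has parameter \<open>lam / (lam + rho n)\<close>, which tends to 1.\<close>
  have yq: "(\<lambda>n. y (s n)) \<longlonglongrightarrow> q"
  proof -
    have d: "dist (Y n k) (y n) = (1 - lam / (lam + rho n)) * dist x (Y n k)" for n
    proof -
      have a: "0 \<le> lam / (lam + rho n)" "lam / (lam + rho n) < 1"
        using lam rho(2)[of n] by (auto simp: add_pos_pos)
      have "gp x (Y n k) (lam / (lam + rho n)) = y n"
        unfolding y_def Y_def by (rule ires_eq[OF nonexpansive_comp_upto[OF F_nonexpansive] a])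
      then show ?thesis using dist_gp_right[of "lam / (lam + rho n)" "Y n k" x] a by simp
    qed
    have "(\<lambda>n. (1 - lam / (lam + rho (s n))) * dist x (Y (s n) k) + dist (Y (s n) k) q)
        \<longlonglongrightarrow> (1 - lam / (lam + 0)) * dist x q + dist q q"
      using lam by (intro tendsto_intros rs qk) auto
    then have lim0: "(\<lambda>n. (1 - lam / (lam + rho (s n))) * dist x (Y (s n) k) + dist (Y (s n) k) q) \<longlonglongrightarrow> 0"
      using lam by simp
    have "(\<lambda>n. dist (y (s n)) q) \<longlonglongrightarrow> 0"
      by (rule tendsto_sandwich[OF _ _ tendsto_const lim0])
        (auto simp: d[symmetric] dist_triangle3)
    then show ?thesis using tendsto_dist_iff by blast
  qed
  define K where "K = m - 2 * lam * (\<Sum>j\<in>{1..k}. b j)"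
  \<comment> \<open>The penalty weight \<open>lam / rho n\<close> is unbounded while the penalty
    stays below \<open>K\<close>, so the distance of \<open>Y n i\<close> to the next closed domain
    tends to 0.\<close>
  have fixed: "nearest (closure (Ds (Suc i))) q = q"
    if i: "Suc i \<le> k" and lim: "(\<lambda>n. Y (s n) i) \<longlonglongrightarrow> q" for i
  proof -
    have bound: "(E (Suc i) (Y (s n) i))\<^sup>2 \<le> K / lam * rho (s n)" for n
    proof -
      let ?n = "s n"
      have "(\<Sum>j\<in>{1..k}. b j) \<le> (\<Sum>j\<in>{1..k}. Gs j (Y ?n j))" using N(2)[OF sN] by (intro sum_mono) auto
      then have "2 * lam * (\<Sum>j\<in>{1..k}. b j) \<le> 2 * lam * (\<Sum>j\<in>{1..k}. Gs j (Y ?n j))"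
        using lam by (intro mult_left_mono) auto
      then have "lam / rho ?n * (\<Sum>j\<in>{1..k}. (E j (Y ?n (j - 1)))\<^sup>2) \<le> K"
        using Y_ineq[of ?n] zero_le_power2[of "dist x (y ?n)"] zero_le_power2[of "dist (y ?n) p"]
        unfolding K_def by linarith
      moreover have "(E (Suc i) (Y ?n (Suc i - 1)))\<^sup>2 \<le> (\<Sum>j\<in>{1..k}. (E j (Y ?n (j - 1)))\<^sup>2)"
        using i by (intro member_le_sum[of "Suc i" _ "\<lambda>j. (E j (Y ?n (j - 1)))\<^sup>2"]) auto
      then have "lam / rho ?n * (E (Suc i) (Y ?n i))\<^sup>2 \<le> lam / rho ?n * (\<Sum>j\<in>{1..k}. (E j (Y ?n (j - 1)))\<^sup>2)"
        using lam rho(2)[of ?n] by (intro mult_left_mono) auto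
      ultimately have "lam / rho ?n * (E (Suc i) (Y ?n i))\<^sup>2 \<le> K" by linarith
      then show ?thesis using lam rho(2)[of ?n] by (simp add: field_simps)
    qed
    have "(\<lambda>n. K / lam * rho (s n)) \<longlonglongrightarrow> K / lam * 0" by (intro tendsto_intros rs)
    then have lim0: "(\<lambda>n. K / lam * rho (s n)) \<longlonglongrightarrow> 0" by simp
    have "(\<lambda>n. (E (Suc i) (Y (s n) i))\<^sup>2) \<longlonglongrightarrow> 0"
      by (rule tendsto_sandwich[OF _ _ tendsto_const lim0]) (use bound in auto)
    moreover have "nonexpansive (nearest (closure (Ds (Suc i))))"
      using i by (intro nonexpansive_nearest convex_lsc_closure[OF summands]) auto
    then have "(\<lambda>n. nearest (closure (Ds (Suc i))) (Y (s n) i)) \<longlonglongrightarrow> nearest (closure (Ds (Suc i))) q"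
      by (rule nonexpansive_tendsto[where F = "\<lambda>_. nearest (closure (Ds (Suc i)))", OF _ lim tendsto_const])
    then have "(\<lambda>n. (E (Suc i) (Y (s n) i))\<^sup>2) \<longlonglongrightarrow> (dist q (nearest (closure (Ds (Suc i))) q))\<^sup>2"
      unfolding E_def by (intro tendsto_power tendsto_dist lim)
    ultimately have "(dist q (nearest (closure (Ds (Suc i))) q))\<^sup>2 = 0"
      using LIMSEQ_unique by blast
    then show ?thesis by simp
  qed
  have Yq: "(\<lambda>n. Y (s n) i) \<longlonglongrightarrow> q" if "i \<le> k" for i
    using that
  proof (induction i)
    case (Suc i)
    then have "(\<lambda>n. Y (s n) i) \<longlonglongrightarrow> q" by simp
    then show ?case using shift[OF Suc.prems] fixed[OF Suc.prems] by metis
  qed (simp add: Y_0 yq)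
  have le: "(\<Sum>j\<in>{1..k}. Gs j (Y (s n) j)) \<le> (m - (dist (y (s n)) p)\<^sup>2 - (dist x (y (s n)))\<^sup>2) / (2 * lam)" for n
  proof -
    have "2 * lam * (\<Sum>j\<in>{1..k}. Gs j (Y (s n) j)) \<le> m - (dist (y (s n)) p)\<^sup>2 - (dist x (y (s n)))\<^sup>2"
      using Y_ineq[of "s n"] Epos[of "s n"] by linarith
    then show ?thesis using lam by (simp add: field_simps)
  qed
  have lim: "(\<lambda>n. (m - (dist (y (s n)) p)\<^sup>2 - (dist x (y (s n)))\<^sup>2) / (2 * lam))
      \<longlonglongrightarrow> (m - (dist q p)\<^sup>2 - (dist x q)\<^sup>2) / (2 * lam)"
    using lam by (intro tendsto_intros yq) auto
  from total_lsc_limit[of "\<lambda>j n. Y (s n) j" q, OF _ _ always_eventually[rule_format, OF le] lim] Yq Y_mem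
  have qD: "q \<in> D" and "G q \<le> (m - (dist q p)\<^sup>2 - (dist x q)\<^sup>2) / (2 * lam)" by auto
  then have "2 * lam * G q \<le> m - (dist q p)\<^sup>2 - (dist x q)\<^sup>2" using lam by (simp add: field_simps)
  moreover have "(dist p q)\<^sup>2 + (dist x p)\<^sup>2 \<le> (dist x q)\<^sup>2 + 2 * lam * (G q - G p)"
    unfolding p_def by (rule prox_evi[OF convex_lsc_total lam qD])
  ultimately have "(dist p q)\<^sup>2 \<le> 0"
    unfolding m_def right_diff_distrib dist_commute[of q p] by linarith
  then have "q = p" by simp
  then show ?thesis using s yq by blast
qed

lemma ires_pflow_subseq:
  "\<exists>s. strict_mono s \<and>
     (\<lambda>n. ires (comp_upto k (\<lambda>j. pflow (Ds j) (Gs j) (rho (s n)))) (lam / (lam + rho (s n))) x) \<longlonglongrightarrow> prox D G lam x"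
  using Y_subseq unfolding y_def F_def p_def .

end

text \<open>If convergence failed, some subsequence would stay away from the limit, yet
  \<open>ires_pflow_subseq\<close> applied to its step sizes extracts a convergent part.\<close>

lemma ires_pflow_tendsto:
  fixes x :: 'a
  assumes lam: "lam > 0" and t: "t > 0" and l: "l \<in> {1..k}" "locally compact (Ds l)"
  shows "(\<lambda>n. ires (comp_upto k (\<lambda>j. pflow (Ds j) (Gs j) (t / real n))) (lam / (lam + t / real n)) x)
    \<longlonglongrightarrow> prox D G lam x"
proof (rule ccontr)
  define y where "y n = ires (comp_upto k (\<lambda>j. pflow (Ds j) (Gs j) (t / real n))) (lam / (lam + t / real n)) x" for n
  assume "\<not> ?thesis"
  then obtain e where e: "e > 0" "\<not> (\<forall>\<^sub>F n in sequentially. dist (y n) (prox D G lam x) < e)"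
    unfolding y_def[symmetric] tendsto_iff by blast
  then have "\<exists>\<^sub>F n in sequentially. \<not> dist (y n) (prox D G lam x) < e"
    by (simp add: not_eventually)
  then have "\<exists>\<^sub>F n in sequentially. n \<ge> 1 \<and> \<not> dist (y n) (prox D G lam x) < e"
    using eventually_ge_at_top[of 1] by (rule frequently_eventually_conj)
  then have "infinite {n. n \<ge> 1 \<and> \<not> dist (y n) (prox D G lam x) < e}"
    by (simp add: frequently_cofinite[symmetric] cofinite_eq_sequentially)
  then obtain r :: "nat \<Rightarrow> nat" where r: "strict_mono r"
      "\<And>n. r n \<in> {n. n \<ge> 1 \<and> \<not> dist (y n) (prox D G lam x) < e}"
    using infinite_enumerate by blast
  have "(\<lambda>n. t / real n) \<longlonglongrightarrow> 0" by (rule lim_const_over_n)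
  then have "(\<lambda>n. t / real (r n)) \<longlonglongrightarrow> 0" using LIMSEQ_subseq_LIMSEQ[OF _ r(1)] by (fastforce simp: o_def)
  moreover have "t / real (r n) > 0" for n using r(2)[of n] t by simp
  ultimately obtain s where "(\<lambda>n. y (r (s n))) \<longlonglongrightarrow> prox D G lam x"
    using ires_pflow_subseq[OF lam _ _ l, of "\<lambda>n. t / real (r n)" x] unfolding y_def by blast
  then have "\<forall>\<^sub>F n in sequentially. dist (y (r (s n))) (prox D G lam x) < e" using e(1) by (rule tendstoD)
  then obtain n where "dist (y (r (s n))) (prox D G lam x) < e" unfolding eventually_sequentially by blast
  then show False using r(2)[of "s n"] by simp
qed

theorem comp_pflow_tendsto_flow:
  fixes x :: 'a
  assumes t: "t > 0" and x: "x \<in> closure D" and l: "l \<in> {1..k}" "locally compact (Ds l)"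
  shows "(\<lambda>n. (comp_upto k (\<lambda>j. pflow (Ds j) (Gs j) (t / real n)) ^^ n) x) \<longlonglongrightarrow> flow D G t x"
proof (intro tendsto_flowI[OF convex_lsc_total t x])
  fix e :: real assume e: "e > 0"
  show "\<exists>M\<ge>1. \<forall>m\<ge>M. \<forall>\<^sub>F n in sequentially.
    dist ((comp_upto k (\<lambda>j. pflow (Ds j) (Gs j) (t / real n)) ^^ n) x) ((prox D G (t / real m) ^^ m) x) < e"
    using t by (intro chernoff[where F = "\<lambda>n. comp_upto k (\<lambda>j. pflow (Ds j) (Gs j) (t / real n))",
        OF t _ ires_pflow_tendsto[OF _ t l] prox_near[OF x] e] nonexpansive_comp_upto nonexpansive_pflow summands) auto
qed

end

section \<open>Extended-real functions\<close>

lemma resolvent_0: "resolvent g 0 = id"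
  by (auto simp: resolvent_def)

lemma semigroup_0: "semigroup g 0 x = x"
  by (simp add: semigroup_def resolvent_0 limI)

lemma comp_upto_fixed:
  assumes "\<And>j. j \<in> {1..k} \<Longrightarrow> F j x = x"
  shows "comp_upto k F x = x"
  using assms by (induction k) auto

lemma comp_upto_cong:
  assumes "\<And>j. j \<in> {1..k} \<Longrightarrow> F j = F' j"
  shows "comp_upto k F = comp_upto k F'"
  using assms by (induction k) auto

section \<open>Translation into domains and real values\<close>

context hadamard
begin

lemma convex_lsc_effdom:
  fixes g :: "'a \<Rightarrow> ereal"
  assumes noninf: "\<And>x. g x \<noteq> -\<infinity>" and conv: "geod_convex g" and lsc: "lsc g"
    and ne: "effdom g \<noteq> {}"
  shows "convex_lsc (effdom g) (\<lambda>x. real_of_ereal (g x))"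
    and "\<And>x. x \<in> effdom g \<Longrightarrow> g x = ereal (real_of_ereal (g x))"
proof -
  show fin: "g x = ereal (real_of_ereal (g x))" if "x \<in> effdom g" for x
    using that noninf[of x] unfolding effdom_def by (cases "g x") auto
  show "convex_lsc (effdom g) (\<lambda>x. real_of_ereal (g x))"
    unfolding convex_lsc_def
  proof (intro conjI ballI allI impI ne; (elim conjE)?)
    fix x y and t :: real
    assume xy: "x \<in> effdom g" "y \<in> effdom g" and t: "t \<in> {0..1}"
    have "g (gp x y ((1 - t) * 0 + t * 1)) \<le> ereal (1 - t) * g (gp x y 0) + ereal t * g (gp x y 1)"
      using conv gp_geodesic(1)[of x y] t unfolding geod_convex_def
      by (metis atLeastAtMost_iff order_refl zero_le_one)
    then have "g (gp x y t) \<le> ereal (1 - t) * g x + ereal t * g y"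
      by (simp add: gp_geodesic)
    also have "\<dots> = ereal ((1 - t) * real_of_ereal (g x) + t * real_of_ereal (g y))"
      by (metis fin[OF xy(1)] fin[OF xy(2)] plus_ereal.simps(1) times_ereal.simps(1))
    finally have le: "g (gp x y t) \<le> ereal ((1 - t) * real_of_ereal (g x) + t * real_of_ereal (g y))" .
    then show mem: "gp x y t \<in> effdom g" unfolding effdom_def by auto
    show "real_of_ereal (g (gp x y t)) \<le> (1 - t) * real_of_ereal (g x) + t * real_of_ereal (g y)"
      using le by (subst (asm) fin[OF mem]) simp
  next
    fix u x a
    assume u: "\<forall>n. u n \<in> effdom g \<and> real_of_ereal (g (u n)) \<le> a" "u \<longlonglongrightarrow> x"
    have "u n \<in> {x. g x \<le> ereal a}" for n using u(1) fin[of "u n"] by (metis ereal_less_eq(3) mem_Collect_eq)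
    then have le: "g x \<le> ereal a"
      using closed_sequentially[of "{x. g x \<le> ereal a}" u x] lsc u(2) unfolding lsc_def by blast
    then show mem: "x \<in> effdom g" unfolding effdom_def by auto
    show "real_of_ereal (g x) \<le> a" using le by (subst (asm) fin[OF mem]) simp
  qed
qed

context
  fixes g :: "'a \<Rightarrow> ereal" and D :: "'a set" and G :: "'a \<Rightarrow> real"
  assumes c: "convex_lsc D G" and dom: "effdom g = D" and val: "\<And>x. x \<in> D \<Longrightarrow> g x = ereal (G x)"
begin

text \<open>Off \<open>D\<close> the objective is infinite, so both minimization problems have the
  same solutions; uniqueness makes \<open>THE\<close> agree with the choice in
  \<open>prox\<close>.\<close>

lemma resolvent_eq_prox:
  assumes lam: "lam > 0"
  shows "resolvent g lam x = prox D G lam x"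
proof -
  have off: "g z = \<infinity>" if "z \<notin> D" for z
    using that unfolding dom[symmetric] effdom_def by simp
  have min: "(\<forall>z. g y + ereal ((dist x y)\<^sup>2 / (2 * lam)) \<le> g z + ereal ((dist x z)\<^sup>2 / (2 * lam))) \<longleftrightarrow>
      y \<in> D \<and> (\<forall>z\<in>D. G y + (dist x y)\<^sup>2 / (2 * lam) \<le> G z + (dist x z)\<^sup>2 / (2 * lam))" (is "?L y \<longleftrightarrow> ?R y") for y
  proof
    assume L: "?L y"
    obtain w where w: "w \<in> D" using convex_lscD(1)[OF c] by blast
    have y: "y \<in> D"
    proof (rule ccontr)
      assume "y \<notin> D"
      then have "\<infinity> \<le> ereal (G w + (dist x w)\<^sup>2 / (2 * lam))" using L[rule_format, of w] off val[OF w] by simp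
      then show False by simp
    qed
    show "?R y"
    proof (intro conjI ballI y)
      fix z assume "z \<in> D"
      then show "G y + (dist x y)\<^sup>2 / (2 * lam) \<le> G z + (dist x z)\<^sup>2 / (2 * lam)"
        using L[rule_format, of z] val[OF y] val by simp
    qed
  next
    assume R: "?R y"
    show "?L y"
    proof
      fix z
      show "g y + ereal ((dist x y)\<^sup>2 / (2 * lam)) \<le> g z + ereal ((dist x z)\<^sup>2 / (2 * lam))"
        using R val off by (cases "z \<in> D") auto
    qed
  qed
  have "(THE y. ?L y) = prox D G lam x"
    unfolding min
  proof (rule the_equality)
    obtain y where y: "?R y" using prox_exists[OF c lam, of x] by blast
    moreover have "y = prox D G lam x" using y by (intro minimizer_eq_prox[OF c lam]) auto
    ultimately show "?R (prox D G lam x)" by simp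
    show "y = prox D G lam x" if "?R y" for y using that by (intro minimizer_eq_prox[OF c lam]) auto
  qed
  then show ?thesis using lam by (simp add: resolvent_def)
qed

lemma semigroup_eq_flow:
  assumes t: "t > 0"
  shows "semigroup g t x = flow D G t x"
proof -
  have "(resolvent g (t / real n) ^^ n) x = (prox D G (t / real n) ^^ n) x" for n
  \<comment> \<open>For \<open>n = 0\<close> the step \<open>t / 0\<close> is 0, but the zeroth
    iterate is \<open>x\<close> on both sides.\<close>
  proof (cases "n = 0")
    case False
    then have "resolvent g (t / real n) = prox D G (t / real n)"
      using t by (intro ext resolvent_eq_prox) simp
    then show ?thesis by simp
  qed simp
  then show ?thesis unfolding semigroup_def flow_def by simp
qed

end

text \<open>Minimizing the distance is the same as minimizing half its square, the resolvent problem
  of the indicator function with step 1.\<close>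

lemma proj_eq_nearest:
  fixes C :: "'a set"
  assumes c: "convex_lsc C (\<lambda>_. 0)"
  shows "proj C x = nearest C x"
proof -
  have eq: "y = prox C (\<lambda>_. 0) 1 x" if "y \<in> C" "\<forall>z\<in>C. dist x y \<le> dist x z" for y
    using that by (intro minimizer_eq_prox[OF c]) (auto simp: power_mono)
  obtain y where y: "y \<in> C" "\<forall>z\<in>C. 0 + (dist x y)\<^sup>2 / (2 * 1) \<le> 0 + (dist x z)\<^sup>2 / (2 * 1)"
    using prox_exists[OF c zero_less_one, of x] by blast
  then have "\<forall>z\<in>C. dist x y \<le> dist x z" by (auto intro: power2_le_imp_le)
  then show ?thesis unfolding proj_def nearest_def using y(1) eq by (intro the_equality) blast+
qed

end

theorem theorem1p4:
  fixes fs :: "nat \<Rightarrow> 'a::metric_space \<Rightarrow> ereal" and k :: nat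
  assumes H: "hadamard_space TYPE('a)"
    and noninf: "\<forall>j\<in>{1..k}. \<forall>x. fs j x \<noteq> -\<infinity>"
    and conv: "\<forall>j\<in>{1..k}. geod_convex (fs j)"
    and lsc: "\<forall>j\<in>{1..k}. lsc (fs j)"
    and fdef: "f = (\<lambda>x. \<Sum>j\<in>{1..k}. fs j x)"
    and notinf: "\<exists>x. f x \<noteq> \<infinity>"
  shows "(\<forall>t\<ge>0. \<forall>x\<in>closure (effdom f).
           (\<lambda>n. (comp_upto k (\<lambda>j. resolvent (fs j) (t / real n)) ^^ n) x)
             \<longlonglongrightarrow> semigroup f t x)
       \<and> ((\<exists>l\<in>{1..k}. locally compact (effdom (fs l))) \<longrightarrow>
          (\<forall>t\<ge>0. \<forall>x\<in>closure (effdom f).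
           (\<lambda>n. (comp_upto k (\<lambda>j. semigroup (fs j) (t / real n) \<circ> proj (closure (effdom (fs j)))) ^^ n) x)
             \<longlonglongrightarrow> semigroup f t x))"
proof -
  interpret hadamard "TYPE('a)" using H by unfold_locales
  define Ds where "Ds j = effdom (fs j)" for j
  define Gs where "Gs j x = real_of_ereal (fs j x)" for j x
  \<comment> \<open>A finite sum of extended reals is infinite exactly when a summand is, so the
    domain of \<open>f\<close> is the intersection of the domains.\<close>
  have fin_iff: "f x \<noteq> \<infinity> \<longleftrightarrow> (\<forall>j\<in>{1..k}. x \<in> Ds j)" for x
    unfolding fdef Ds_def effdom_def by (auto simp: sum_Pinfty)
  have ne: "Ds j \<noteq> {}" if "j \<in> {1..k}" for j using notinf fin_iff that by blast
  have summand: "convex_lsc (Ds j) (Gs j)" "\<And>x. x \<in> Ds j \<Longrightarrow> fs j x = ereal (Gs j x)"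
    if j: "j \<in> {1..k}" for j
    using convex_lsc_effdom[of "fs j"] ne[OF j] noninf conv lsc j unfolding Ds_def Gs_def by auto
  interpret splitting "TYPE('a)" k Ds Gs
  proof
    show "(\<Inter>j\<in>{1..k}. Ds j) \<noteq> {}" using notinf fin_iff by blast
  qed (rule summand)
  have dom: "effdom f = D" unfolding D_def effdom_def using fin_iff by (auto simp: less_top[symmetric])
  have val: "f x = ereal (G x)" if "x \<in> D" for x
  proof -
    have "f x = (\<Sum>j\<in>{1..k}. ereal (Gs j x))"
      unfolding fdef using that summand(2) by (intro sum.cong refl) (auto simp: D_def)
    then show ?thesis by (simp add: G_def)
  qed
  note semi_f = semigroup_eq_flow[OF convex_lsc_total dom val]
  have closure_mem: "x \<in> closure (Ds j)" if "j \<in> {1..k}" "x \<in> closure (effdom f)" for j x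
    using that closure_mono[of D "Ds j"] unfolding dom D_def by blast
  have proj_eq: "proj (closure (Ds j)) = nearest (closure (Ds j))" if "j \<in> {1..k}" for j
    using proj_eq_nearest[OF convex_lsc_closure[OF summand(1)[OF that]]] by blast
  have funpow_fixed: "(F ^^ n) x = x" if "F x = x" for F :: "'a \<Rightarrow> 'a" and n x
    using that by (induction n) auto
  show ?thesis
  proof (intro conjI impI allI ballI)
    fix t :: real and x assume t: "t \<ge> 0" and x: "x \<in> closure (effdom f)"
    show "(\<lambda>n. (comp_upto k (\<lambda>j. resolvent (fs j) (t / real n)) ^^ n) x) \<longlonglongrightarrow> semigroup f t x"
    proof (cases "t = 0")
      case True
      then show ?thesis by (simp add: semigroup_0 resolvent_0 funpow_fixed comp_upto_fixed)
    next
      case False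
      have "(comp_upto k (\<lambda>j. resolvent (fs j) (t / real n)) ^^ n) x
          = (comp_upto k (\<lambda>j. prox (Ds j) (Gs j) (t / real n)) ^^ n) x" for n
      proof (cases "n = 0")
        case n: False
        have "comp_upto k (\<lambda>j. resolvent (fs j) (t / real n)) = comp_upto k (\<lambda>j. prox (Ds j) (Gs j) (t / real n))"
          using n t False summand
          by (intro comp_upto_cong ext resolvent_eq_prox) (auto simp: Ds_def)
        then show ?thesis by simp
      qed simp
      then show ?thesis
        using comp_prox_tendsto_flow[of t x] semi_f[of t x] t False x unfolding dom by simp
    qed
  next
    fix t :: real and x
    assume "\<exists>l\<in>{1..k}. locally compact (effdom (fs l))" and t: "t \<ge> 0" and x: "x \<in> closure (effdom f)"
    then obtain l where l: "l \<in> {1..k}" "locally compact (Ds l)" unfolding Ds_def by blast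
    show "(\<lambda>n. (comp_upto k (\<lambda>j. semigroup (fs j) (t / real n) \<circ> proj (closure (effdom (fs j)))) ^^ n) x)
        \<longlonglongrightarrow> semigroup f t x"
      unfolding Ds_def[symmetric]
    proof (cases "t = 0")
      case True
      \<comment> \<open>At time 0 the semigroups are the identity, and \<open>x\<close> lies in the
        closure of every domain, so the whole composition fixes \<open>x\<close>.\<close>
      have "proj (closure (Ds j)) x = x" if j: "j \<in> {1..k}" for j
        using proj_eq[OF j] nearest_id[OF convex_lsc_closure[OF summand(1)[OF j]] closure_mem[OF j x]] by simp
      then have "comp_upto k (\<lambda>j. semigroup (fs j) 0 \<circ> proj (closure (Ds j))) x = x"
        by (intro comp_upto_fixed) (simp add: semigroup_0)
      then show "(\<lambda>n. (comp_upto k (\<lambda>j. semigroup (fs j) (t / real n) \<circ> proj (closure (Ds j))) ^^ n) x)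
          \<longlonglongrightarrow> semigroup f t x"
        using True by (simp add: semigroup_0 funpow_fixed)
    next
      case False
      have "(comp_upto k (\<lambda>j. semigroup (fs j) (t / real n) \<circ> proj (closure (Ds j))) ^^ n) x
          = (comp_upto k (\<lambda>j. pflow (Ds j) (Gs j) (t / real n)) ^^ n) x" for n
      proof (cases "n = 0")
        case n: False
        have "semigroup (fs j) (t / real n) = flow (Ds j) (Gs j) (t / real n)" if j: "j \<in> {1..k}" for j
          using n t False summand[OF j] by (intro ext semigroup_eq_flow) (auto simp: Ds_def)
        then have "comp_upto k (\<lambda>j. semigroup (fs j) (t / real n) \<circ> proj (closure (Ds j)))
            = comp_upto k (\<lambda>j. pflow (Ds j) (Gs j) (t / real n))"
          by (intro comp_upto_cong) (simp add: pflow_def proj_eq)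
        then show ?thesis by simp
      qed simp
      then show "(\<lambda>n. (comp_upto k (\<lambda>j. semigroup (fs j) (t / real n) \<circ> proj (closure (Ds j))) ^^ n) x)
          \<longlonglongrightarrow> semigroup f t x"
        using comp_pflow_tendsto_flow[of t x, OF _ _ l] semi_f[of t x] t False x unfolding dom by simp
    qed
  qed
qed

end
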